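(* Let $d\in\mathbb N$, let $\alpha\in\mathbb R$, $\alpha\neq 0$, let $(X_n)_{n\in\mathbb Z^d}$ and $(Y_n)_{n\in\mathbb Z^d}$ be families of complex Banach spaces, let $s>(d+1)^2$ and $\omega(j)=(1+|j|)^s$, $j\in\mathbb Z^d$. Let $\mathbb A=(a_{mn})_{m,n\in\mathbb Z^d}$, $a_{mn}:X_n\to Y_m$, be an operator matrix in $\Sigma^\omega_\alpha$. Then $\mathbb A$ is bounded below in $\ell^p$ for some $p\in[1,\infty]$ if and only if $\mathbb A$ is bounded below in $\ell^q$ for all $q\in[1,\infty]$.
   Context: For $n\in\mathbb Z^d$, $|n|=\max_{1\le k\le d}|n_k|$. For a family $(X_n)_{n\in\mathbb Z^d}$ of complex Banach spaces, $\ell^p(\mathbb Z^d,(X_n))$ is the Banach space of sequences $x=(x_n)$, $x_n\in X_n$, with norm $\|x\|_p=(\sum_n\|x_n\|_{X_n}^p)^{1/p}$ ($1\le p<\infty$), $\|x\|_\infty=\sup_n\|x_n\|_{X_n}$. An operator matrix $\mathbb A=(a_{mn})_{m,n\in\mathbb Z^d}$ consists of bounded linear operators $a_{mn}:X_n\to Y_m$. Put $\|\mathbb A\|_{\sup}=\sup_{m,n}\|a_{mn}\|$. Fix $\alpha\ne0$. For $j\in\mathbb Z^d$ the $j$-th $\alpha$-slant of $\mathbb A$ is the matrix $A_j=(a^{(j)}_{mn})$ with $a^{(j)}_{mn}=a_{mn}\prod_{k=1}^d\chi_{[j_k,j_k+1)}(\alpha m_k-n_k)$. Let $K=\lceil|\alpha|^{-1}\rceil^d$.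 For a weight $\omega:\mathbb Z^d\to[1,\infty)$, $\Sigma^\omega_\alpha$ is the class of matrices $\mathbb A$ with $\|\mathbb A\|_{\Sigma^\omega_\alpha}=K\sum_{j\in\mathbb Z^d}\|A_j\|_{\sup}\,\omega(j)<\infty$. Every $\mathbb A\in\Sigma_\alpha^\omega$ defines, by $(\mathbb Ax)_m=\sum_n a_{mn}x_n$, a bounded operator $\ell^p(\mathbb Z^d,(X_n))\to\ell^p(\mathbb Z^d,(Y_n))$ for every $p\in[1,\infty]$. $\mathbb A$ is bounded below in $\ell^p$ if there is a constant $\kappa_p>0$ with $\|\mathbb Ax\|_p\ge\kappa_p\|x\|_p$ for all $x\in\ell^p(\mathbb Z^d,(X_n))$. *)

theory Defs
  imports "HOL-Analysis.Analysis" "HOL-Algebra.Module"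
begin

text \<open>
  A family of Banach spaces cannot be a family of types, so a complex Banach space is a structure
  with an explicit carrier: a HOL-Algebra module over the field of complex numbers together with a
  norm. As usual for modules in HOL-Algebra, the record fields \<open>mult\<close> and \<open>one\<close> inherited from
  \<open>ring\<close> carry no meaning. All members of a family live on a common type of elements, but carriers
  and operations are otherwise unrelated.
\<close>

definition complex_field :: "complex ring" where
  "complex_field = \<lparr>carrier = UNIV, monoid.mult = (*), one = 1, ring.zero = 0, add = (+)\<rparr>"

record 'a normed_module = "(complex, 'a) module" +
  vnorm :: "'a \<Rightarrow> real"

definition vdist :: "('a, 'b) normed_module_scheme \<Rightarrow> 'a \<Rightarrow> 'a \<Rightarrow> real" where
  \<comment> \<open>\<open>Metric_space\<close> wants symmetry and nonnegativity outside the carrier as well\<close>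
  "vdist M x y = (if x \<in> carrier M \<and> y \<in> carrier M then vnorm M (x \<ominus>\<^bsub>M\<^esub> y) else 0)"

locale complex_normed_space =
  Module.module complex_field M
  for M :: "('a, 'b) normed_module_scheme" (structure) +
  assumes vnorm_nonneg: "x \<in> carrier M \<Longrightarrow> 0 \<le> vnorm M x"
    and vnorm_eq_0_iff: "x \<in> carrier M \<Longrightarrow> vnorm M x = 0 \<longleftrightarrow> x = \<zero>\<^bsub>M\<^esub>"
    and vnorm_triangle:
      "\<lbrakk>x \<in> carrier M; y \<in> carrier M\<rbrakk> \<Longrightarrow> vnorm M (x \<oplus>\<^bsub>M\<^esub> y) \<le> vnorm M x + vnorm M y"
    and vnorm_smult: "x \<in> carrier M \<Longrightarrow> vnorm M (c \<odot>\<^bsub>M\<^esub> x) = cmod c * vnorm M x"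
begin

lemma vnorm_uminus: "x \<in> carrier M \<Longrightarrow> vnorm M (\<ominus>\<^bsub>M\<^esub> x) = vnorm M x"
proof -
  assume x: "x \<in> carrier M"
  let ?R = "complex_field"
  have one: "\<one>\<^bsub>?R\<^esub> = 1" "1 \<in> carrier ?R"
    by (auto simp: complex_field_def)
  have "\<ominus>\<^bsub>M\<^esub> x = (\<ominus>\<^bsub>?R\<^esub> 1) \<odot>\<^bsub>M\<^esub> x"
    using x one smult_l_minus[of 1 x] smult_one[of x] by simp
  moreover have "\<ominus>\<^bsub>?R\<^esub> 1 = - (1::complex)"
  proof (rule R.minus_equality)
    show "- 1 \<oplus>\<^bsub>?R\<^esub> 1 = \<zero>\<^bsub>?R\<^esub>" by (simp add: complex_field_def)
  qed (auto simp: complex_field_def)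
  ultimately show ?thesis using x by (simp add: vnorm_smult)
qed

sublocale metric: Metric_space "carrier M" "vdist M"
proof
  fix x y
  show "0 \<le> vdist M x y"
    by (auto simp: vdist_def vnorm_nonneg)
  show "vdist M x y = vdist M y x"
  proof (cases "x \<in> carrier M \<and> y \<in> carrier M")
    case True
    then have "\<ominus>\<^bsub>M\<^esub> (x \<ominus>\<^bsub>M\<^esub> y) = y \<ominus>\<^bsub>M\<^esub> x"
      by (simp add: M.minus_add M.minus_eq M.a_comm)
    with True show ?thesis
      using vnorm_uminus[of "x \<ominus>\<^bsub>M\<^esub> y"] by (simp add: vdist_def)
  qed (auto simp: vdist_def)
next
  fix x y assume *: "x \<in> carrier M" "y \<in> carrier M"
  then have "(x \<ominus>\<^bsub>M\<^esub> y) \<oplus>\<^bsub>M\<^esub> y = x"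
    by (simp add: M.minus_eq M.a_assoc M.l_neg)
  with * have "x \<ominus>\<^bsub>M\<^esub> y = \<zero>\<^bsub>M\<^esub> \<longleftrightarrow> x = y"
    by (metis M.l_zero M.minus_eq M.r_neg)
  with * show "vdist M x y = 0 \<longleftrightarrow> x = y"
    by (simp add: vdist_def vnorm_eq_0_iff)
next
  fix x y z assume *: "x \<in> carrier M" "y \<in> carrier M" "z \<in> carrier M"
  then have "(x \<ominus>\<^bsub>M\<^esub> y) \<oplus>\<^bsub>M\<^esub> (y \<ominus>\<^bsub>M\<^esub> z) = x \<ominus>\<^bsub>M\<^esub> z"
    by (simp add: M.minus_eq M.a_assoc M.r_neg1)
  with * show "vdist M x z \<le> vdist M x y + vdist M y z"
    using vnorm_triangle[of "x \<ominus>\<^bsub>M\<^esub> y" "y \<ominus>\<^bsub>M\<^esub> z"] by (simp add: vdist_def)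
qed

end

locale complex_banach_space = complex_normed_space +
  assumes complete: "metric.mcomplete"

definition bounded_operator ::
    "'a normed_module \<Rightarrow> 'b normed_module \<Rightarrow> ('a \<Rightarrow> 'b) \<Rightarrow> bool" where
  "bounded_operator V W f \<longleftrightarrow>
     f \<in> carrier V \<rightarrow> carrier W \<and>
     (\<forall>x\<in>carrier V. \<forall>y\<in>carrier V. f (x \<oplus>\<^bsub>V\<^esub> y) = f x \<oplus>\<^bsub>W\<^esub> f y) \<and>
     (\<forall>c. \<forall>x\<in>carrier V. f (c \<odot>\<^bsub>V\<^esub> x) = c \<odot>\<^bsub>W\<^esub> f x) \<and>
     (\<exists>C. \<forall>x\<in>carrier V. vnorm W (f x) \<le> C * vnorm V x)"

definition op_norm :: "'a normed_module \<Rightarrow> 'b normed_module \<Rightarrow> ('a \<Rightarrow> 'b) \<Rightarrow> real" where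
  "op_norm V W f = (SUP x\<in>{x \<in> carrier V. vnorm V x \<le> 1}. vnorm W (f x))"

definition lp_space :: "('i \<Rightarrow> 'a normed_module) \<Rightarrow> ereal \<Rightarrow> ('i \<Rightarrow> 'a) set" where
  "lp_space X p = {x. (\<forall>n. x n \<in> carrier (X n)) \<and>
     (if p = \<infinity> then bdd_above (range (\<lambda>n. vnorm (X n) (x n)))
      else (\<lambda>n. vnorm (X n) (x n) powr real_of_ereal p) summable_on UNIV)}"

definition lp_norm :: "('i \<Rightarrow> 'a normed_module) \<Rightarrow> ereal \<Rightarrow> ('i \<Rightarrow> 'a) \<Rightarrow> real" where
  "lp_norm X p x =
     (if p = \<infinity> then SUP n. vnorm (X n) (x n)
      else (\<Sum>\<^sub>\<infinity>n. vnorm (X n) (x n) powr real_of_ereal p) powr (1 / real_of_ereal p))"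

type_synonym ('i, 'a, 'b) op_matrix = "'i \<Rightarrow> 'i \<Rightarrow> 'a \<Rightarrow> 'b"

definition matrix_sup_norm ::
    "('i \<Rightarrow> 'a normed_module) \<Rightarrow> ('i \<Rightarrow> 'b normed_module) \<Rightarrow> ('i, 'a, 'b) op_matrix \<Rightarrow> ennreal" where
  "matrix_sup_norm X Y A = (SUP m. SUP n. ennreal (op_norm (X n) (Y m) (A m n)))"

text \<open>
  \<open>(A x)\<^sub>m\<close> is the unordered sum of the \<open>A\<^sub>m\<^sub>n x\<^sub>n\<close>, i.e. the limit in \<open>Y\<^sub>m\<close> of the sums over finite
  index sets. For matrices in the class \<open>slant_class\<close> below and \<open>x\<close> in some \<open>lp_space X p\<close>, the
  series converges absolutely, so the limit exists.
\<close>

definition matrix_apply ::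
    "('i \<Rightarrow> 'b normed_module) \<Rightarrow> ('i, 'a, 'b) op_matrix \<Rightarrow> ('i \<Rightarrow> 'a) \<Rightarrow> 'i \<Rightarrow> 'b" where
  "matrix_apply Y A x m =
     (THE y. limitin (Metric_space.mtopology (carrier (Y m)) (vdist (Y m)))
               (\<lambda>F. finsum (Y m) (\<lambda>n. A m n (x n)) F) y (finite_subsets_at_top UNIV))"

definition bounded_below ::
    "('i \<Rightarrow> 'a normed_module) \<Rightarrow> ('i \<Rightarrow> 'b normed_module) \<Rightarrow> ('i, 'a, 'b) op_matrix \<Rightarrow> ereal \<Rightarrow> bool"
  where
  "bounded_below X Y A p \<longleftrightarrow>
     (\<exists>\<kappa>>0. \<forall>x\<in>lp_space X p. lp_norm Y p (matrix_apply Y A x) \<ge> \<kappa> * lp_norm X p x)"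

definition sup_abs :: "int ^ 'd::finite \<Rightarrow> int" where
  "sup_abs n = Max (range (\<lambda>k. \<bar>n $ k\<bar>))"

definition slant ::
    "real \<Rightarrow> (int ^ 'd \<Rightarrow> 'b normed_module) \<Rightarrow> (int ^ 'd::finite, 'a, 'b) op_matrix \<Rightarrow> int ^ 'd \<Rightarrow>
     (int ^ 'd, 'a, 'b) op_matrix" where
  "slant \<alpha> Y A j m n x =
     (\<Prod>k\<in>UNIV. indicator {real_of_int (j $ k)..<real_of_int (j $ k) + 1}
                  (\<alpha> * real_of_int (m $ k) - real_of_int (n $ k))) \<odot>\<^bsub>Y m\<^esub> A m n x"

definition slant_norm ::
    "real \<Rightarrow> (int ^ 'd \<Rightarrow> real) \<Rightarrow> (int ^ 'd \<Rightarrow> 'a normed_module) \<Rightarrow> (int ^ 'd \<Rightarrow> 'b normed_module) \<Rightarrow>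
     (int ^ 'd::finite, 'a, 'b) op_matrix \<Rightarrow> ennreal" where
  "slant_norm \<alpha> \<omega> X Y A =
     of_nat (nat \<lceil>1 / \<bar>\<alpha>\<bar>\<rceil> ^ CARD('d)) *
     (\<Sum>\<^sub>\<infinity>j. matrix_sup_norm X Y (slant \<alpha> Y A j) * ennreal (\<omega> j))"

definition slant_class ::
    "real \<Rightarrow> (int ^ 'd \<Rightarrow> real) \<Rightarrow> (int ^ 'd \<Rightarrow> 'a normed_module) \<Rightarrow> (int ^ 'd \<Rightarrow> 'b normed_module) \<Rightarrow>
     (int ^ 'd::finite, 'a, 'b) op_matrix set" where
  "slant_class \<alpha> \<omega> X Y =
     {A. (\<forall>m n. bounded_operator (X n) (Y m) (A m n)) \<and> slant_norm \<alpha> \<omega> X Y A < \<infinity>}"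

end

theory Submission
  imports Defs
begin

text \<open>
  Write \<open>h m\<close> for the componentwise integer part of \<open>\<alpha> m\<close>. The entry \<open>a\<^sub>m\<^sub>n\<close> lies on the slant with
  index \<open>h m - n\<close>, so the norms of the entries are bounded by \<open>b (h m - n)\<close>, where \<open>b\<close> is summable
  against a high power of \<open>1 + \<bar>j\<bar>\<close>. Kernels of the form \<open>g (h m - n)\<close> with summable \<open>g\<close> have bounded
  row and column sums, because \<open>h\<close> has fibres of bounded size, and by Schur's test (\<open>schur_test\<close>) they
  act boundedly on \<open>\<ell>\<^sup>p\<close> for every \<open>p\<close>.

  A lower bound in one \<open>\<ell>\<^sup>p\<close> is turned into a pointwise estimate in which \<open>p\<close> no longer occurs. For
  this, \<open>x\<close> is multiplied by the bump \<open>\<phi> n = (1 + \<epsilon> \<bar>n - k\<bar>) ^ (- 2 d)\<close> centred at \<open>k\<close>. A bump with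
  polynomial tails changes slowly relative to its own size: \<open>\<bar>\<phi> n - \<phi> i\<bar>\<close> is at most
  \<open>\<epsilon> (1 + \<bar>i - n\<bar>) ^ (2 d) \<phi> n\<close> (\<open>bump_slowly_varying\<close>). Hence the commutator of the matrix with the
  bump, applied to \<open>x\<close>, is bounded by \<open>\<epsilon>\<close> times a Schur kernel applied to \<open>\<phi> x\<close> itself
  (\<open>commutator_bound\<close>). For small \<open>\<epsilon>\<close> the lower bound for \<open>\<phi> x\<close> absorbs this error. As \<open>\<phi> k = 1\<close>, and as the norm in
  \<open>\<ell>\<^sup>p\<close> is at most the norm in \<open>\<ell>\<^sup>1\<close>, what is left is (\<open>bounded_below_pointwise\<close>)

  \<open>\<parallel>x\<^sub>k\<parallel> \<le> C \<Sum>\<^sub>m (1 + \<epsilon> \<bar>h m - k\<bar>) ^ (- 2 d) \<parallel>(A x)\<^sub>m\<parallel>\<close>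

  for all bounded \<open>x\<close> and all \<open>k\<close>. The bump is summable over the lattice, so the right-hand side is
  another Schur kernel, and Schur's test gives the lower bound in every \<open>\<ell>\<^sup>q\<close>.
\<close>

section \<open>Nonnegative families in \<open>\<ell>\<^sup>p\<close>\<close>

text \<open>
  All estimates are made on the families of norms of vectors, so the sequence spaces enter only
  through nonnegative real families. \<open>family_norm\<close> repeats the formula of \<open>lp_norm\<close>, which makes
  \<open>lp_norm X p x\<close> the \<open>family_norm\<close> of \<open>\<lambda>n. vnorm (X n) (x n)\<close> by mere unfolding.
\<close>

definition lp_family :: "ereal \<Rightarrow> ('i \<Rightarrow> real) \<Rightarrow> bool" where
  "lp_family p u \<longleftrightarrow> (\<forall>n. 0 \<le> u n) \<and>
     (if p = \<infinity> then bdd_above (range u)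
      else (\<lambda>n. u n powr real_of_ereal p) summable_on UNIV)"

definition family_norm :: "ereal \<Rightarrow> ('i \<Rightarrow> real) \<Rightarrow> real" where
  "family_norm p u =
     (if p = \<infinity> then SUP n. u n
      else (\<Sum>\<^sub>\<infinity>n. u n powr real_of_ereal p) powr (1 / real_of_ereal p))"

lemma exponent_cases:
  fixes p :: ereal
  assumes "p \<in> {1..\<infinity>}"
  obtains (infinite) "p = \<infinity>" | (finite) r where "p = ereal r" "1 \<le> r"
  using assms by (cases p) (auto simp: one_ereal_def)

lemma lp_family_nonneg: "lp_family p u \<Longrightarrow> 0 \<le> u n"
  by (simp add: lp_family_def)

lemma family_norm_nonneg: "lp_family p u \<Longrightarrow> 0 \<le> family_norm p u"
  by (auto simp: lp_family_def family_norm_def intro: cSUP_upper2)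

lemma finite_sum_le_nonneg_infsum:
  fixes u :: "'i \<Rightarrow> real"
  assumes "\<And>n. 0 \<le> u n" "u summable_on UNIV" "finite F"
  shows "sum u F \<le> (\<Sum>\<^sub>\<infinity>n. u n)"
  using assms by (intro finite_sum_le_infsum) auto

lemma bounded_sums_summable:
  fixes u :: "'i \<Rightarrow> real"
  assumes "\<And>n. 0 \<le> u n" "\<And>F. finite F \<Longrightarrow> sum u F \<le> L"
  shows "u summable_on UNIV" and "(\<Sum>\<^sub>\<infinity>n. u n) \<le> L"
proof -
  show "u summable_on UNIV"
    using assms by (intro nonneg_bdd_above_summable_on bdd_aboveI) auto
  then show "(\<Sum>\<^sub>\<infinity>n. u n) \<le> L"
    using assms by (intro infsum_le_finite_sums) auto
qed

lemma summable_mono: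
  fixes u v :: "'i \<Rightarrow> real"
  assumes "\<And>n. 0 \<le> u n" "\<And>n. u n \<le> v n" "v summable_on UNIV"
  shows "u summable_on UNIV" and "(\<Sum>\<^sub>\<infinity>n. u n) \<le> (\<Sum>\<^sub>\<infinity>n. v n)"
proof -
  have v: "\<And>n. 0 \<le> v n" using assms order_trans by blast
  have "sum u F \<le> (\<Sum>\<^sub>\<infinity>n. v n)" if "finite F" for F
    using finite_sum_le_nonneg_infsum[OF v assms(3) that] sum_mono[of F u v] assms(2)
    by fastforce
  from bounded_sums_summable[of u, OF assms(1) this]
  show "u summable_on UNIV" and "(\<Sum>\<^sub>\<infinity>n. u n) \<le> (\<Sum>\<^sub>\<infinity>n. v n)" by auto
qed

lemma powr_le_iff_le_root:
  fixes x y r :: real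
  assumes "0 \<le> x" "0 \<le> y" "1 \<le> r"
  shows "x powr r \<le> y \<longleftrightarrow> x \<le> y powr (1 / r)"
proof -
  have "(x powr r) powr (1 / r) = x" "(y powr (1 / r)) powr r = y"
    using assms by (auto simp: powr_powr)
  then show ?thesis
    using assms powr_mono2[of "1 / r" "x powr r" y] powr_mono2[of r x "y powr (1 / r)"]
    by auto
qed

lemma lp_bounded:
  assumes "p \<in> {1..\<infinity>}" "lp_family p u"
  shows "u n \<le> family_norm p u"
  using assms(1)
proof (cases rule: exponent_cases)
  case infinite
  with assms(2) show ?thesis
    by (auto simp: lp_family_def family_norm_def intro: cSUP_upper)
next
  case (finite r)
  with assms(2) have "(\<lambda>n. u n powr r) summable_on UNIV" and u: "\<And>n. 0 \<le> u n"
    by (auto simp: lp_family_def)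
  from finite_sum_le_nonneg_infsum[OF _ this(1), of "{n}"]
  have "u n powr r \<le> (\<Sum>\<^sub>\<infinity>n. u n powr r)" by simp
  then show ?thesis
    using finite u[of n] powr_le_iff_le_root[of "u n" _ r]
    by (simp add: family_norm_def infsum_nonneg)
qed

lemma lp_mono:
  assumes "p \<in> {1..\<infinity>}" "lp_family p v" "\<And>n. 0 \<le> u n" "\<And>n. u n \<le> v n"
  shows "lp_family p u" and "family_norm p u \<le> family_norm p v"
  unfolding atomize_conj
  using assms(1)
proof (cases rule: exponent_cases)
  case infinite
  have v: "bdd_above (range v)" using infinite assms(2) by (simp add: lp_family_def)
  have "u n \<le> (SUP n. v n)" for n
    using assms(4)[of n] v by (auto intro: cSUP_upper2)
  then show "lp_family p u \<and> family_norm p u \<le> family_norm p v"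
    using infinite assms(3)
    by (auto simp: lp_family_def family_norm_def intro!: cSUP_least bdd_aboveI2)
next
  case (finite r)
  have v: "(\<lambda>n. v n powr r) summable_on UNIV"
    using finite assms(2) by (simp add: lp_family_def)
  have "u n powr r \<le> v n powr r" for n
    using finite assms(3,4) by (intro powr_mono2) auto
  note * = summable_mono[of "\<lambda>n. u n powr r", OF _ this v]
  then show "lp_family p u \<and> family_norm p u \<le> family_norm p v"
    using * finite assms(3)
    by (auto simp: lp_family_def family_norm_def intro!: powr_mono2 infsum_nonneg)
qed

lemma lp_cmult:
  assumes "p \<in> {1..\<infinity>}" "lp_family p u" "0 \<le> c"
  shows "lp_family p (\<lambda>n. c * u n)" and "family_norm p (\<lambda>n. c * u n) = c * family_norm p u"
  unfolding atomize_conj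
  using assms(1)
proof (cases rule: exponent_cases)
  case infinite
  have u: "bdd_above (range u)" using infinite assms(2) by (simp add: lp_family_def)
  have le: "c * u n \<le> c * (SUP n. u n)" for n
    using u assms(3) by (intro mult_left_mono cSUP_upper) auto
  then have bdd: "bdd_above (range (\<lambda>n. c * u n))" by (intro bdd_aboveI2)
  then have "lp_family p (\<lambda>n. c * u n)"
    using infinite assms by (simp add: lp_family_def)
  moreover have "c * (SUP n. u n) \<le> (SUP n. c * u n)"
  proof (cases "c = 0")
    case False
    then have c: "0 < c" using assms(3) by simp
    have "u n \<le> (SUP n. c * u n) / c" for n
      using cSUP_upper[OF _ bdd, of n] c by (simp add: field_simps)
    then have "(SUP n. u n) \<le> (SUP n. c * u n) / c" by (intro cSUP_least) auto
    then show ?thesis using c by (simp add: field_simps)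
  qed simp
  ultimately show "lp_family p (\<lambda>n. c * u n) \<and> family_norm p (\<lambda>n. c * u n) = c * family_norm p u"
    using infinite le by (auto simp: family_norm_def intro!: antisym cSUP_least)
next
  case (finite r)
  have u: "(\<lambda>n. u n powr r) summable_on UNIV" "\<And>n. 0 \<le> u n"
    using finite assms(2) by (auto simp: lp_family_def)
  have eq: "(c * u n) powr r = c powr r * u n powr r" for n
    using assms(3) u(2) by (simp add: powr_mult)
  show "lp_family p (\<lambda>n. c * u n) \<and> family_norm p (\<lambda>n. c * u n) = c * family_norm p u"
    using finite u assms(3)
    by (simp add: lp_family_def summable_on_cmult_right family_norm_def eq infsum_cmult_right powr_mult infsum_nonneg powr_powr)
qed

text \<open>
  Each of the bases \<open>t = a\<close> and \<open>t = b\<close> satisfies \<open>t powr r \<le> t * (a + b) powr (r - 1)\<close>.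
\<close>

lemma powr_add_superadditive:
  fixes a b r :: real
  assumes "0 \<le> a" "0 \<le> b" "1 \<le> r"
  shows "a powr r + b powr r \<le> (a + b) powr r"
proof -
  have "t powr r \<le> t * (a + b) powr (r - 1)" if "0 \<le> t" "t \<le> a + b" for t
  proof (cases "t = 0")
    case False
    then have "t powr r = t * t powr (r - 1)"
      using that by (simp add: powr_diff)
    then show ?thesis using that assms by (auto intro!: mult_left_mono powr_mono2)
  qed simp
  from this[of a] this[of b] assms
  have "a powr r + b powr r \<le> (a + b) * (a + b) powr (r - 1)"
    by (simp add: algebra_simps)
  also have "\<dots> = (a + b) powr r" using assms by (cases "a + b = 0") (auto simp: powr_diff)
  finally show ?thesis .
qed

lemma powr_add_le:
  fixes a b r :: real
  assumes "0 \<le> a" "0 \<le> b" "1 \<le> r"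
  shows "(a + b) powr r \<le> 2 powr r * (a powr r + b powr r)"
proof -
  have "(a + b) powr r \<le> (2 * max a b) powr r"
    using assms by (intro powr_mono2) auto
  also have "\<dots> = 2 powr r * max a b powr r" using assms by (simp add: powr_mult)
  also have "\<dots> \<le> 2 powr r * (a powr r + b powr r)"
    by (intro mult_left_mono) (auto simp: max_def)
  finally show ?thesis .
qed

text \<open>
  A quasi-triangle inequality. The constant \<open>2\<close> is harmless below, where the second summand
  carries an arbitrarily small factor.
\<close>

lemma lp_add:
  assumes "p \<in> {1..\<infinity>}" "lp_family p u" "lp_family p v"
  shows "lp_family p (\<lambda>n. u n + v n)"
    and "family_norm p (\<lambda>n. u n + v n) \<le> 2 * (family_norm p u + family_norm p v)"
  unfolding atomize_conj
  using assms(1)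
proof (cases rule: exponent_cases)
  case infinite
  have le: "u n + v n \<le> family_norm p u + family_norm p v" for n
    using assms lp_bounded by (intro add_mono) auto
  then have "bdd_above (range (\<lambda>n. u n + v n))" by (intro bdd_aboveI2)
  then have "lp_family p (\<lambda>n. u n + v n)"
    using infinite assms by (auto simp: lp_family_def)
  moreover have "family_norm p (\<lambda>n. u n + v n) \<le> family_norm p u + family_norm p v"
    using le infinite by (subst family_norm_def) (auto intro!: cSUP_least)
  ultimately show "lp_family p (\<lambda>n. u n + v n) \<and>
    family_norm p (\<lambda>n. u n + v n) \<le> 2 * (family_norm p u + family_norm p v)"
    using family_norm_nonneg[OF assms(2)] family_norm_nonneg[OF assms(3)] by simp
next
  case (finite r)
  have u: "(\<lambda>n. u n powr r) summable_on UNIV" "\<And>n. 0 \<le> u n"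
    and v: "(\<lambda>n. v n powr r) summable_on UNIV" "\<And>n. 0 \<le> v n"
    using finite assms(2,3) by (auto simp: lp_family_def)
  define U where "U = (\<Sum>\<^sub>\<infinity>n. u n powr r)"
  define V where "V = (\<Sum>\<^sub>\<infinity>n. v n powr r)"
  have [simp]: "0 \<le> U" "0 \<le> V" by (auto simp: U_def V_def infsum_nonneg)
  have "(\<lambda>n. 2 powr r * (u n powr r + v n powr r)) summable_on UNIV"
    using u v by (intro summable_on_cmult_right summable_on_add)
  from summable_mono[OF _ powr_add_le this]
  have *: "(\<lambda>n. (u n + v n) powr r) summable_on UNIV"
    "(\<Sum>\<^sub>\<infinity>n. (u n + v n) powr r) \<le> 2 powr r * (U + V)"
    using finite u v
    by (auto simp: U_def V_def infsum_cmult_right infsum_add summable_on_add)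
  have fam: "lp_family p (\<lambda>n. u n + v n)" using * finite u v by (simp add: lp_family_def)
  have "U + V \<le> (U powr (1 / r) + V powr (1 / r)) powr r"
    using powr_add_superadditive[of "U powr (1 / r)" "V powr (1 / r)" r] finite
    by (simp add: powr_powr)
  then have "2 powr r * (U + V) \<le> (2 * (U powr (1 / r) + V powr (1 / r))) powr r"
    by (simp only: powr_mult) (simp add: mult_left_mono)
  with *(2) have "(\<Sum>\<^sub>\<infinity>n. (u n + v n) powr r) \<le> (2 * (U powr (1 / r) + V powr (1 / r))) powr r"
    by linarith
  then have "(\<Sum>\<^sub>\<infinity>n. (u n + v n) powr r) powr (1 / r) \<le>
      ((2 * (U powr (1 / r) + V powr (1 / r))) powr r) powr (1 / r)"
    using finite by (intro powr_mono2) (auto intro: infsum_nonneg)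
  then show "lp_family p (\<lambda>n. u n + v n) \<and>
    family_norm p (\<lambda>n. u n + v n) \<le> 2 * (family_norm p u + family_norm p v)"
    using fam finite by (simp add: family_norm_def powr_powr U_def V_def)
qed

text \<open>
  \<open>\<ell>\<^sup>1 \<subseteq> \<ell>\<^sup>p\<close> contractively: with \<open>S\<close> the sum of \<open>u\<close>, each \<open>u n powr r\<close> is at most
  \<open>S powr (r - 1) * u n\<close>. Using the \<open>\<ell>\<^sup>1\<close> norm as an upper bound is what makes the localized
  estimate independent of \<open>p\<close>.
\<close>

lemma summable_imp_lp:
  assumes "p \<in> {1..\<infinity>}" "\<And>n. 0 \<le> u n" "u summable_on UNIV"
  shows "lp_family p u" and "family_norm p u \<le> (\<Sum>\<^sub>\<infinity>n. u n)"
  unfolding atomize_conj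
  using assms(1)
proof (cases rule: exponent_cases)
  case infinite
  have le: "u n \<le> (\<Sum>\<^sub>\<infinity>n. u n)" for n
    using finite_sum_le_nonneg_infsum[of u "{n}"] assms by simp
  then have "bdd_above (range u)" by (intro bdd_aboveI2)
  then show "lp_family p u \<and> family_norm p u \<le> (\<Sum>\<^sub>\<infinity>n. u n)"
    using infinite assms(2) le by (auto simp: lp_family_def family_norm_def intro: cSUP_least)
next
  case (finite r)
  define S where "S = (\<Sum>\<^sub>\<infinity>n. u n)"
  have S: "0 \<le> S" using assms(2) by (auto simp: S_def intro: infsum_nonneg)
  have "u n powr r \<le> S powr (r - 1) * u n" for n
  proof (cases "u n = 0")
    case False
    then have "u n powr r = u n powr (r - 1) * u n"
      using assms(2)[of n] by (simp add: powr_diff)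
    moreover have "u n \<le> S"
      using finite_sum_le_nonneg_infsum[of u "{n}"] assms by (simp add: S_def)
    ultimately show ?thesis
      using finite assms(2)[of n] by (auto intro!: mult_right_mono powr_mono2)
  qed simp
  from summable_mono[OF _ this summable_on_cmult_right[OF assms(3)]]
  have *: "(\<lambda>n. u n powr r) summable_on UNIV"
    "(\<Sum>\<^sub>\<infinity>n. u n powr r) \<le> S powr (r - 1) * S"
    using assms(3) by (auto simp: infsum_cmult_right S_def)
  moreover have "S powr (r - 1) * S = S powr r"
    using S by (cases "S = 0") (auto simp: powr_diff)
  ultimately have "(\<Sum>\<^sub>\<infinity>n. u n powr r) powr (1 / r) \<le> (S powr r) powr (1 / r)"
    using finite by (intro powr_mono2) (auto intro: infsum_nonneg)
  then show "lp_family p u \<and> family_norm p u \<le> (\<Sum>\<^sub>\<infinity>n. u n)"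
    using * finite assms(2) S by (auto simp: lp_family_def family_norm_def powr_powr S_def)
qed

lemma infsum_finite_sum:
  fixes f :: "'a \<Rightarrow> 'b \<Rightarrow> real"
  assumes "\<And>i. (\<lambda>n. f i n) summable_on A"
  shows "(\<Sum>\<^sub>\<infinity>n\<in>A. \<Sum>i\<in>I. f i n) = (\<Sum>i\<in>I. \<Sum>\<^sub>\<infinity>n\<in>A. f i n)"
proof -
  have "((\<lambda>n. \<Sum>i\<in>I. f i n) has_sum (\<Sum>i\<in>I. \<Sum>\<^sub>\<infinity>n\<in>A. f i n)) A"
    using assms
    by (induction I rule: infinite_finite_induct) (auto intro!: has_sum_add has_sum_infsum)
  then show ?thesis by (rule infsumI)
qed

text \<open>
  The bounds are put on finite partial sums, so that summability of rows and columns is part of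
  the definition.
\<close>

definition schur_kernel :: "real \<Rightarrow> ('m \<Rightarrow> 'n \<Rightarrow> real) \<Rightarrow> bool" where
  "schur_kernel L c \<longleftrightarrow> 0 < L \<and> (\<forall>m n. 0 \<le> c m n) \<and>
     (\<forall>m F. finite F \<longrightarrow> (\<Sum>n\<in>F. c m n) \<le> L) \<and> (\<forall>n G. finite G \<longrightarrow> (\<Sum>m\<in>G. c m n) \<le> L)"

lemma schur_kernel_mult_summable:
  assumes "schur_kernel L c" "\<And>n. 0 \<le> u n" "\<And>n. u n \<le> B"
  shows "(\<lambda>n. c m n * u n) summable_on UNIV" and "(\<Sum>\<^sub>\<infinity>n. c m n * u n) \<le> L * B"
proof -
  have c: "0 \<le> c m n" "finite F \<Longrightarrow> (\<Sum>n\<in>F. c m n) \<le> L" for n F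
    using assms(1) by (auto simp: schur_kernel_def)
  have B: "0 \<le> B" using assms(2,3) order_trans by blast
  have "(\<Sum>n\<in>F. c m n * u n) \<le> L * B" if "finite F" for F
  proof -
    have "(\<Sum>n\<in>F. c m n * u n) \<le> (\<Sum>n\<in>F. c m n) * B"
      unfolding sum_distrib_right using c assms(3) by (intro sum_mono mult_left_mono) auto
    also have "\<dots> \<le> L * B" using c(2)[OF that] B by (intro mult_right_mono)
    finally show ?thesis .
  qed
  from bounded_sums_summable[of "\<lambda>n. c m n * u n", OF _ this]
  show "(\<lambda>n. c m n * u n) summable_on UNIV" and "(\<Sum>\<^sub>\<infinity>n. c m n * u n) \<le> L * B"
    using c assms(2) by auto
qed

text \<open>
  Schur's test. For finite \<open>p = r\<close> the row estimate
  \<open>(\<Sum>\<^sub>\<infinity>n. c m n * u n) powr r \<le> 2 powr r * L powr (r - 1) * (\<Sum>\<^sub>\<infinity>n. c m n * u n powr r)\<close>,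
  a form of Jensen's inequality, is summed over \<open>m\<close> and the column bound is applied. Up to the
  factor \<open>2 powr r\<close>, Jensen's inequality follows by cutting \<open>u\<close> at a level \<open>y\<close>: one always has
  \<open>u n \<le> y + y powr (1 - r) * u n powr r\<close>, and with \<open>y\<close> half of the row value divided by \<open>L\<close>
  the first term can be absorbed.
\<close>

lemma schur_test:
  assumes "p \<in> {1..\<infinity>}" and c: "schur_kernel L c" and u: "lp_family p u"
  shows "lp_family p (\<lambda>m. \<Sum>\<^sub>\<infinity>n. c m n * u n)"
    and "family_norm p (\<lambda>m. \<Sum>\<^sub>\<infinity>n. c m n * u n) \<le> 2 * L * family_norm p u"
proof -
  define T where "T m = (\<Sum>\<^sub>\<infinity>n. c m n * u n)" for m
  have L: "0 < L" and c0: "\<And>m n. 0 \<le> c m n" using c by (auto simp: schur_kernel_def)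
  have u0: "\<And>n. 0 \<le> u n" and ub: "\<And>n. u n \<le> family_norm p u"
    using lp_bounded[OF assms(1) u] lp_family_nonneg[OF u] by auto
  note cu = schur_kernel_mult_summable[OF c u0 ub]
  have T0: "0 \<le> T m" for m unfolding T_def using c0 u0 by (intro infsum_nonneg) simp
  have "lp_family p T \<and> family_norm p T \<le> 2 * L * family_norm p u"
    using assms(1)
  proof (cases rule: exponent_cases)
    case infinite
    have le: "T m \<le> L * family_norm p u" for m using cu(2) by (simp add: T_def)
    then have "bdd_above (range T)" by (intro bdd_aboveI2)
    moreover have "(SUP m. T m) \<le> L * family_norm p u" using le by (intro cSUP_least) auto
    moreover have "0 \<le> L * family_norm p u" using L family_norm_nonneg[OF u] by simp
    ultimately show ?thesis using infinite T0 by (simp add: lp_family_def family_norm_def)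
  next
    case (finite r)
    have ur: "(\<lambda>n. u n powr r) summable_on UNIV" using finite u by (auto simp: lp_family_def)
    define S where "S = (\<Sum>\<^sub>\<infinity>n. u n powr r)"
    have S0: "0 \<le> S" by (auto simp: S_def intro: infsum_nonneg)
    have "u n powr r \<le> S" for n
      using finite_sum_le_nonneg_infsum[OF _ ur, of "{n}"] by (simp add: S_def)
    note cur = schur_kernel_mult_summable[OF c _ this, simplified]
    have jensen: "T m powr r \<le> 2 powr r * L powr (r - 1) * (\<Sum>\<^sub>\<infinity>n. c m n * u n powr r)"
      (is "_ \<le> _ * ?R") for m
    proof (cases "T m = 0")
      case True
      then show ?thesis using L c0 by (auto intro!: mult_nonneg_nonneg infsum_nonneg)
    next
      case False
      then have Tm: "0 < T m" using T0[of m] by simp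
      \<comment> \<open>the level for which the low part of \<open>u\<close> contributes at most half of \<open>T m\<close>\<close>
      define y where "y = T m / (2 * L)"
      have y: "0 < y" using Tm L by (simp add: y_def)
      have cut: "u n \<le> y + y powr (1 - r) * u n powr r" for n
      proof (cases "u n \<le> y")
        case True then show ?thesis by (simp add: add_increasing2)
      next
        case False
        then have "u n powr (1 - r) \<le> y powr (1 - r)" using y finite by (intro powr_mono2') auto
        then have "u n powr (1 - r) * u n powr r \<le> y powr (1 - r) * u n powr r"
          by (intro mult_right_mono) auto
        moreover have "u n powr (1 - r) * u n powr r = u n"
          using False y by (simp flip: powr_add)
        ultimately show ?thesis using y by simp
      qed
      have "(\<lambda>n. c m n) summable_on UNIV" "(\<Sum>\<^sub>\<infinity>n. c m n) \<le> L"
        using schur_kernel_mult_summable[OF c, of "\<lambda>_. 1" 1 m] by auto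
      note cs = this
      have "T m \<le> (\<Sum>\<^sub>\<infinity>n. c m n * y + y powr (1 - r) * (c m n * u n powr r))"
        unfolding T_def
      proof (rule summable_mono(2))
        show "c m n * u n \<le> c m n * y + y powr (1 - r) * (c m n * u n powr r)" for n
          using mult_left_mono[OF cut c0] by (simp add: algebra_simps)
        show "(\<lambda>n. c m n * y + y powr (1 - r) * (c m n * u n powr r)) summable_on UNIV"
          using cs cur(1) by (intro summable_on_add summable_on_cmult_right summable_on_cmult_left)
      qed (use c0 u0 in auto)
      also have "\<dots> = (\<Sum>\<^sub>\<infinity>n. c m n) * y + y powr (1 - r) * ?R"
        using cs cur(1)
        by (simp add: infsum_add summable_on_cmult_right summable_on_cmult_left
            infsum_cmult_right infsum_cmult_left)
      also have "\<dots> \<le> L * y + y powr (1 - r) * ?R" using cs y by simp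
      finally have "L * y \<le> y powr (1 - r) * ?R" using L by (simp add: y_def)
      then have "y powr (r - 1) * (L * y) \<le> y powr (r - 1) * (y powr (1 - r) * ?R)"
        by (intro mult_left_mono) auto
      also have "\<dots> = ?R" using y by (simp add: mult.assoc[symmetric] flip: powr_add)
      also have "y powr (r - 1) * (L * y) = L * y powr r"
        using y by (simp add: powr_diff)
      finally have "L * y powr r \<le> ?R" .
      then have "2 powr r * L powr (r - 1) * (L * y powr r) \<le> 2 powr r * L powr (r - 1) * ?R"
        by (intro mult_left_mono) auto
      moreover have "2 powr r * L powr (r - 1) * (L * y powr r) = T m powr r"
      proof -
        have "2 powr r * L powr (r - 1) * (L * y powr r) = (2 * L * y) powr r"
          using L y by (simp add: powr_diff powr_mult)
        then show ?thesis using L by (simp add: y_def)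
      qed
      ultimately show ?thesis by simp
    qed
    have "(\<Sum>m\<in>G. T m powr r) \<le> (2 * L) powr r * S" if G: "finite G" for G
    proof -
      have "(\<Sum>m\<in>G. \<Sum>\<^sub>\<infinity>n. c m n * u n powr r) = (\<Sum>\<^sub>\<infinity>n. \<Sum>m\<in>G. c m n * u n powr r)"
        using cur(1) by (intro infsum_finite_sum[symmetric]) auto
      also have "\<dots> \<le> (\<Sum>\<^sub>\<infinity>n. L * u n powr r)"
        using G c c0
        by (intro summable_mono(2) summable_on_cmult_right ur sum_nonneg)
           (auto simp: schur_kernel_def simp flip: sum_distrib_right intro!: mult_right_mono)
      also have "\<dots> = L * S" using ur by (simp add: infsum_cmult_right S_def)
      finally have *: "(\<Sum>m\<in>G. \<Sum>\<^sub>\<infinity>n. c m n * u n powr r) \<le> L * S" .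
      have "(\<Sum>m\<in>G. T m powr r) \<le>
          2 powr r * L powr (r - 1) * (\<Sum>m\<in>G. \<Sum>\<^sub>\<infinity>n. c m n * u n powr r)"
        unfolding sum_distrib_left using jensen by (intro sum_mono)
      also have "\<dots> \<le> 2 powr r * L powr (r - 1) * (L * S)"
        using * by (intro mult_left_mono) auto
      also have "\<dots> = (2 * L) powr r * S" using L by (simp add: powr_diff powr_mult)
      finally show ?thesis .
    qed
    from bounded_sums_summable[of "\<lambda>m. T m powr r", OF _ this]
    have *: "(\<lambda>m. T m powr r) summable_on UNIV" "(\<Sum>\<^sub>\<infinity>m. T m powr r) \<le> (2 * L) powr r * S"
      by auto
    have "(\<Sum>\<^sub>\<infinity>m. T m powr r) powr (1 / r) \<le> ((2 * L) powr r * S) powr (1 / r)"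
      using *(2) finite by (intro powr_mono2) (auto intro: infsum_nonneg)
    also have "\<dots> = 2 * L * S powr (1 / r)"
      using finite L by (simp add: powr_mult powr_powr)
    finally show ?thesis using * finite T0 by (simp add: lp_family_def family_norm_def S_def)
  qed
  then show "lp_family p (\<lambda>m. \<Sum>\<^sub>\<infinity>n. c m n * u n)"
    and "family_norm p (\<lambda>m. \<Sum>\<^sub>\<infinity>n. c m n * u n) \<le> 2 * L * family_norm p u"
    unfolding T_def by auto
qed

section \<open>The lattice: fibres, convolution kernels and bumps\<close>

lemma sup_abs_ge: "\<bar>n $ k\<bar> \<le> sup_abs n"
  unfolding sup_abs_def by (intro Max_ge) auto

lemma sup_abs_le_iff: "sup_abs n \<le> c \<longleftrightarrow> (\<forall>k. \<bar>n $ k\<bar> \<le> c)"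
  unfolding sup_abs_def by (subst Max_le_iff) auto

lemma sup_abs_nonneg: "0 \<le> sup_abs n"
  using sup_abs_ge[of n undefined] by linarith

lemma sup_abs_0 [simp]: "sup_abs 0 = 0"
  using sup_abs_le_iff[of 0 0] sup_abs_nonneg[of 0] by (metis abs_zero antisym order_refl zero_index)

lemma sup_abs_minus_commute: "sup_abs (m - n) = sup_abs (n - m)"
  unfolding sup_abs_def by (simp add: abs_minus_commute)

lemma sup_abs_triangle: "sup_abs (m - k) \<le> sup_abs (m - n) + sup_abs (n - k)"
  unfolding sup_abs_le_iff
proof
  fix i
  show "\<bar>(m - k) $ i\<bar> \<le> sup_abs (m - n) + sup_abs (n - k)"
    using sup_abs_ge[of "m - n" i] sup_abs_ge[of "n - k" i] by simp
qed

lemma abs_diff_sup_abs_le: "\<bar>sup_abs (m - k) - sup_abs (n - k)\<bar> \<le> sup_abs (m - n)"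
  using sup_abs_triangle[of m k n] sup_abs_triangle[of n k m] sup_abs_minus_commute[of m n] by linarith

lemma finite_lattice_box: "finite {v :: int ^ 'd::finite. \<forall>k. v $ k \<in> Z}" if "finite Z"
proof (rule finite_subset)
  show "{v :: int ^ 'd. \<forall>k. v $ k \<in> Z} \<subseteq> vec_lambda ` (\<Pi>\<^sub>E k\<in>UNIV. Z)"
  proof
    fix v :: "int ^ 'd" assume "v \<in> {v. \<forall>k. v $ k \<in> Z}"
    then have "($) v \<in> (\<Pi>\<^sub>E k\<in>UNIV. Z)" by (auto simp: PiE_iff)
    then have "vec_lambda (($) v) \<in> vec_lambda ` (\<Pi>\<^sub>E k\<in>UNIV. Z)" by (rule imageI)
    then show "v \<in> vec_lambda ` (\<Pi>\<^sub>E k\<in>UNIV. Z)" by simp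
  qed
  show "finite (vec_lambda ` (\<Pi>\<^sub>E k\<in>(UNIV :: 'd set). Z))"
    using that by (intro finite_imageI finite_PiE) auto
qed

text \<open>
  For \<open>\<bar>\<alpha>\<bar> < 1\<close> several rows of a slanted matrix have the same diagonal position; column sums are
  controlled because their number is bounded.
\<close>

definition bounded_fibres :: "nat \<Rightarrow> ('a \<Rightarrow> 'b) \<Rightarrow> bool" where
  "bounded_fibres K h \<longleftrightarrow> (\<forall>i. finite {m. h m = i} \<and> card {m. h m = i} \<le> K)"

lemma sum_le_bounded_fibres:
  fixes g :: "'b \<Rightarrow> real"
  assumes "bounded_fibres K h" "\<And>i. 0 \<le> g i" "finite G"
  shows "(\<Sum>m\<in>G. g (h m)) \<le> real K * sum g (h ` G)"
proof -
  have "(\<Sum>m\<in>G. g (h m)) = (\<Sum>i\<in>h ` G. \<Sum>m\<in>{m \<in> G. h m = i}. g (h m))"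
    using assms(3) by (rule sum.image_gen)
  also have "\<dots> = (\<Sum>i\<in>h ` G. real (card {m \<in> G. h m = i}) * g i)"
    by (intro sum.cong) auto
  also have "\<dots> \<le> (\<Sum>i\<in>h ` G. real K * g i)"
  proof (intro sum_mono mult_right_mono assms(2))
    fix i
    have "card {m \<in> G. h m = i} \<le> card {m. h m = i}"
      using assms(1) by (intro card_mono) (auto simp: bounded_fibres_def)
    then show "real (card {m \<in> G. h m = i}) \<le> real K"
      using assms(1) by (auto simp: bounded_fibres_def intro: order_trans)
  qed
  finally show ?thesis by (simp add: sum_distrib_left)
qed

text \<open>
  The position of the slanted diagonal in row \<open>m\<close>. Since the columns \<open>n\<close> are integral, the entry
  \<open>a\<^sub>m\<^sub>n\<close> belongs to the slant with index exactly \<open>slope_floor \<alpha> m - n\<close>, so \<open>\<alpha>\<close> enters the proof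
  only through this map.
\<close>

definition slope_floor :: "real \<Rightarrow> int ^ 'd \<Rightarrow> int ^ 'd::finite" where
  "slope_floor \<alpha> m = (\<chi> k. \<lfloor>\<alpha> * real_of_int (m $ k)\<rfloor>)"

text \<open>
  Two points of one fibre differ by less than \<open>1 / \<bar>\<alpha>\<bar>\<close> in each coordinate, so every fibre lies in
  a translate of one fixed finite box.
\<close>

lemma slope_floor_bounded_fibres:
  assumes "\<alpha> \<noteq> 0"
  shows "\<exists>K. bounded_fibres K (slope_floor \<alpha> :: int ^ 'd::finite \<Rightarrow> _)"
proof -
  define L where "L = \<lceil>1 / \<bar>\<alpha>\<bar>\<rceil>"
  define B :: "(int ^ 'd) set" where "B = {v. \<forall>k. v $ k \<in> {-L..L}}"
  have fin: "finite B" unfolding B_def by (rule finite_lattice_box) simp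
  have sub: "{m. slope_floor \<alpha> m = i} \<subseteq> (+) m0 ` B" if m0: "slope_floor \<alpha> m0 = i" for i m0
  proof
    fix m assume "m \<in> {m. slope_floor \<alpha> m = i}"
    with m0 have eq: "\<lfloor>\<alpha> * real_of_int (m $ k)\<rfloor> = \<lfloor>\<alpha> * real_of_int (m0 $ k)\<rfloor>" for k
      by (auto simp: slope_floor_def vec_eq_iff)
    have "\<bar>(m - m0) $ k\<bar> \<le> L" for k
    proof -
      have "\<bar>\<alpha> * real_of_int (m $ k) - \<alpha> * real_of_int (m0 $ k)\<bar> < 1"
        using eq[of k] by linarith
      then have "\<bar>\<alpha>\<bar> * real_of_int \<bar>(m - m0) $ k\<bar> < 1"
        by (simp add: abs_mult[symmetric] right_diff_distrib)
      then have "real_of_int \<bar>(m - m0) $ k\<bar> < 1 / \<bar>\<alpha>\<bar>"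
        using assms by (simp add: field_simps)
      then show ?thesis unfolding L_def by linarith
    qed
    then have "- L \<le> (m - m0) $ k" "(m - m0) $ k \<le> L" for k
      by (meson abs_le_iff minus_le_iff)+
    then have "m - m0 \<in> B" unfolding B_def by (simp only: mem_Collect_eq atLeastAtMost_iff) blast
    then have "m0 + (m - m0) \<in> (+) m0 ` B" by (rule imageI)
    then show "m \<in> (+) m0 ` B" by simp
  qed
  have "finite {m :: int ^ 'd. slope_floor \<alpha> m = i} \<and> card {m. slope_floor \<alpha> m = i} \<le> card B" for i
  proof (cases "{m. slope_floor \<alpha> m = i} = {}")
    case False
    then obtain m0 where "slope_floor \<alpha> m0 = i" by auto
    from sub[OF this] show ?thesis
      using fin by (meson card_image_le card_mono finite_imageI finite_subset order_trans)
  qed (simp only: finite.emptyI card.empty le0 simp_thms)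
  then show ?thesis unfolding bounded_fibres_def by blast
qed

lemma schur_kernel_transpose: "schur_kernel L c \<Longrightarrow> schur_kernel L (\<lambda>n m. c m n)"
  by (simp add: schur_kernel_def)

text \<open>
  Rows are reflected translates of \<open>g\<close>; a column visits each value of a translate of \<open>g\<close> at most
  \<open>K\<close> times.
\<close>

lemma convolution_schur_kernel:
  fixes g :: "'b::ab_group_add \<Rightarrow> real"
  assumes h: "bounded_fibres K h" and g: "\<And>i. 0 \<le> g i" "g summable_on UNIV"
  shows "\<exists>L. schur_kernel L (\<lambda>m n. g (h m - n))"
proof -
  define S where "S = (\<Sum>\<^sub>\<infinity>i. g i)"
  have S: "0 \<le> S" "finite F \<Longrightarrow> sum g F \<le> S" for F
    using finite_sum_le_nonneg_infsum[of g, OF g] g(1) by (auto simp: S_def intro: infsum_nonneg)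
  have "(\<Sum>n\<in>F. g (h m - n)) \<le> (real K + 1) * S + 1" if "finite F" for m F
  proof -
    have "(\<Sum>n\<in>F. g (h m - n)) = sum g ((\<lambda>n. h m - n) ` F)"
      by (subst sum.reindex) (auto simp: inj_on_def)
    also have "\<dots> \<le> S" using that by (intro S) auto
    also have "\<dots> \<le> (real K + 1) * S + 1" using S(1) by (simp add: algebra_simps)
    finally show ?thesis .
  qed
  moreover have "(\<Sum>m\<in>G. g (h m - n)) \<le> (real K + 1) * S + 1" if "finite G" for n G
  proof -
    have "(\<Sum>m\<in>G. g (h m - n)) \<le> real K * (\<Sum>i\<in>h ` G. g (i - n))"
      using sum_le_bounded_fibres[of K h "\<lambda>i. g (i - n)", OF h g(1) that] by simp
    also have "(\<Sum>i\<in>h ` G. g (i - n)) = sum g ((\<lambda>i. i - n) ` h ` G)"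
      by (subst sum.reindex) (auto simp: inj_on_def)
    also have "\<dots> \<le> S" using that by (intro S) auto
    finally have "(\<Sum>m\<in>G. g (h m - n)) \<le> real K * S" by (simp add: mult_left_mono)
    then show ?thesis using S(1) by (simp add: algebra_simps)
  qed
  \<comment> \<open>the summand \<open>1\<close> keeps the constant positive when \<open>g\<close> vanishes\<close>
  moreover have "0 < (real K + 1) * S + 1" using S(1) by (simp add: add_nonneg_pos)
  ultimately have "schur_kernel ((real K + 1) * S + 1) (\<lambda>m n. g (h m - n))"
    using g(1) unfolding schur_kernel_def by blast
  then show ?thesis ..
qed

text \<open>
  The localizing weight. It is strictly positive rather than compactly supported, so that it
  varies slowly relative to its own size (\<open>bump_slowly_varying\<close>); the exponent is twice the
  dimension so that it is dominated by a product of inverse squares of the coordinates and is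
  therefore summable.
\<close>

definition bump :: "real \<Rightarrow> int ^ 'd::finite \<Rightarrow> real" where
  "bump \<epsilon> i = inverse ((1 + \<epsilon> * real_of_int (sup_abs i)) ^ (2 * CARD('d)))"

lemma bump_pos: "0 \<le> \<epsilon> \<Longrightarrow> 0 < bump \<epsilon> i"
  unfolding bump_def using sup_abs_nonneg[of i] by (simp add: add_pos_nonneg)

lemma bump_0 [simp]: "bump \<epsilon> 0 = 1"
  by (simp add: bump_def)

text \<open>
  The absolute value maps the integers to the naturals with fibres of at most two points, which
  reduces the claim to the series of inverse squares.
\<close>

lemma summable_on_int_inverse_square:
  assumes "0 < \<epsilon>"
  shows "(\<lambda>z::int. inverse ((1 + \<epsilon> * \<bar>real_of_int z\<bar>)\<^sup>2)) summable_on UNIV"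
proof -
  let ?f = "\<lambda>n::nat. inverse ((1 + \<epsilon> * real n)\<^sup>2)"
  have "summable ?f"
  proof (rule summable_comparison_test')
    show "summable (\<lambda>n. inverse (\<epsilon>\<^sup>2) * inverse (real n ^ 2))"
      using inverse_power_summable[of 2, where 'a = real] by (intro summable_mult) simp
    show "norm (?f n) \<le> inverse (\<epsilon>\<^sup>2) * inverse (real n ^ 2)" if "1 \<le> n" for n
    proof -
      have "(\<epsilon> * real n)\<^sup>2 \<le> (1 + \<epsilon> * real n)\<^sup>2"
        using assms by (intro power_mono) auto
      then have "inverse ((1 + \<epsilon> * real n)\<^sup>2) \<le> inverse ((\<epsilon> * real n)\<^sup>2)"
        using assms that by (intro le_imp_inverse_le) auto
      then show ?thesis by (simp add: power_mult_distrib)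
    qed
  qed
  then have f: "?f summable_on UNIV" by (subst summable_on_UNIV_nonneg_real_iff) auto
  have "{m. nat \<bar>m\<bar> = i} \<subseteq> {int i, - int i}" for i by auto
  moreover have "card {int i, - int i} \<le> 2" for i by (simp add: card_insert_if)
  ultimately have fib: "bounded_fibres 2 (\<lambda>z. nat \<bar>z\<bar>)"
    unfolding bounded_fibres_def
    by (meson card_mono finite.emptyI finite.insertI finite_subset order_trans)
  show ?thesis
  proof (rule bounded_sums_summable)
    fix F :: "int set" assume F: "finite F"
    have "(\<Sum>z\<in>F. ?f (nat \<bar>z\<bar>)) \<le> real 2 * sum ?f ((\<lambda>z. nat \<bar>z\<bar>) ` F)"
      by (rule sum_le_bounded_fibres[OF fib _ F]) simp
    also have "\<dots> \<le> real 2 * (\<Sum>\<^sub>\<infinity>n. ?f n)"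
      using F f by (intro mult_left_mono finite_sum_le_nonneg_infsum) auto
    finally show "(\<Sum>z\<in>F. inverse ((1 + \<epsilon> * \<bar>real_of_int z\<bar>)\<^sup>2)) \<le> real 2 * (\<Sum>\<^sub>\<infinity>n. ?f n)"
      by simp
  qed simp
qed

text \<open>
  Every coordinate is bounded by the maximum norm, so \<open>bump\<close> is at most a product of one-dimensional
  inverse squares, and a sum of such products over a box factorizes.
\<close>

lemma bump_summable:
  assumes "0 < \<epsilon>"
  shows "(bump \<epsilon> :: int ^ 'd::finite \<Rightarrow> real) summable_on UNIV"
proof (rule bounded_sums_summable)
  let ?g = "\<lambda>z::int. inverse ((1 + \<epsilon> * \<bar>real_of_int z\<bar>)\<^sup>2)"
  fix F :: "(int ^ 'd) set" assume F: "finite F"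
  define Z where "Z = (\<Union>k. (\<lambda>i. i $ k) ` F)"
  have Z: "finite Z" using F by (auto simp: Z_def)
  have "bump \<epsilon> i \<le> (\<Prod>k\<in>UNIV. ?g (i $ k))" for i :: "int ^ 'd"
  proof -
    have "(\<Prod>k\<in>UNIV. (1 + \<epsilon> * \<bar>real_of_int (i $ k)\<bar>)\<^sup>2)
        \<le> (\<Prod>k\<in>(UNIV::'d set). (1 + \<epsilon> * real_of_int (sup_abs i))\<^sup>2)"
    proof (intro prod_mono conjI power_mono)
      fix k
      have "\<bar>real_of_int (i $ k)\<bar> \<le> real_of_int (sup_abs i)"
        using sup_abs_ge[of i k] by linarith
      then show "1 + \<epsilon> * \<bar>real_of_int (i $ k)\<bar> \<le> 1 + \<epsilon> * real_of_int (sup_abs i)"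
        using assms by simp
    qed (use assms in auto)
    moreover have "0 < (\<Prod>k\<in>UNIV. (1 + \<epsilon> * \<bar>real_of_int (i $ k)\<bar>)\<^sup>2)"
      using assms by (intro prod_pos ballI zero_less_power add_pos_nonneg) auto
    ultimately have "inverse (\<Prod>k\<in>(UNIV::'d set). (1 + \<epsilon> * real_of_int (sup_abs i))\<^sup>2)
        \<le> inverse (\<Prod>k\<in>UNIV. (1 + \<epsilon> * \<bar>real_of_int (i $ k)\<bar>)\<^sup>2)"
      by (rule le_imp_inverse_le)
    moreover have "inverse (\<Prod>k\<in>UNIV. (1 + \<epsilon> * \<bar>real_of_int (i $ k)\<bar>)\<^sup>2) = (\<Prod>k\<in>UNIV. ?g (i $ k))"
      unfolding prod_inversef[symmetric] comp_def ..
    ultimately show ?thesis by (simp add: bump_def power_mult)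
  qed
  then have "sum (bump \<epsilon>) F \<le> (\<Sum>i\<in>F. \<Prod>k\<in>UNIV. ?g (i $ k))" by (intro sum_mono)
  also have "\<dots> = (\<Sum>f\<in>($) ` F. \<Prod>k\<in>UNIV. ?g (f k))"
    by (subst sum.reindex) (auto simp: inj_on_def vec_nth_inject)
  also have "\<dots> \<le> (\<Sum>f\<in>(\<Pi>\<^sub>E k\<in>UNIV. Z). \<Prod>k\<in>(UNIV::'d set). ?g (f k))"
    using Z by (intro sum_mono2 finite_PiE prod_nonneg) (auto simp: PiE_iff Z_def)
  also have "\<dots> = (\<Prod>k\<in>(UNIV::'d set). \<Sum>z\<in>Z. ?g z)"
    using Z by (subst prod_sum_PiE) auto
  also have "\<dots> \<le> (\<Prod>k\<in>(UNIV::'d set). \<Sum>\<^sub>\<infinity>z. ?g z)"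
    using Z summable_on_int_inverse_square[OF assms]
    by (intro prod_mono conjI finite_sum_le_nonneg_infsum sum_nonneg) auto
  finally show "sum (bump \<epsilon>) F \<le> (\<Prod>k\<in>(UNIV::'d set). \<Sum>\<^sub>\<infinity>z. ?g z)" .
qed (use bump_pos[of \<epsilon>] assms in \<open>auto intro: less_imp_le\<close>)

text \<open>
  Convexity of \<open>(1 + \<epsilon> * \<delta>) ^ r\<close> in \<open>\<epsilon>\<close>: on \<open>[0, 1]\<close> its graph lies below the chord.
\<close>

lemma one_plus_scaled_power_le:
  fixes \<epsilon> \<delta> :: real
  assumes "0 \<le> \<epsilon>" "\<epsilon> \<le> 1" "0 \<le> \<delta>"
  shows "(1 + \<epsilon> * \<delta>) ^ r - 1 \<le> \<epsilon> * ((1 + \<delta>) ^ r - 1)"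
proof (induction r)
  case (Suc r)
  have "(1 + \<epsilon> * \<delta>) ^ Suc r - 1 = (1 + \<epsilon> * \<delta>) * ((1 + \<epsilon> * \<delta>) ^ r - 1) + \<epsilon> * \<delta>"
    by (simp add: algebra_simps)
  also have "\<dots> \<le> (1 + \<delta>) * (\<epsilon> * ((1 + \<delta>) ^ r - 1)) + \<epsilon> * \<delta>"
    using assms Suc one_le_power[of "1 + \<epsilon> * \<delta>" r]
    by (intro add_right_mono mult_mono) (auto simp: mult_left_le_one_le)
  also have "\<dots> = \<epsilon> * ((1 + \<delta>) ^ Suc r - 1)" by (simp add: algebra_simps)
  finally show ?case .
qed simp

text \<open>
  The two values of \<open>1 + \<epsilon> * \<bar>\<cdot> - k\<bar>\<close> at \<open>n\<close> and \<open>i\<close> have a ratio between the inverse of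
  \<open>1 + \<epsilon> * \<bar>i - n\<bar>\<close> and \<open>1 + \<epsilon> * \<bar>i - n\<bar>\<close>, so the relative change of the bump is at most the
  \<open>(2 d)\<close>-th power of that number minus one. By convexity this is \<open>\<epsilon>\<close> times a quantity that does not
  depend on \<open>\<epsilon>\<close>: it grows polynomially in \<open>\<bar>i - n\<bar>\<close>, and the decay of the matrix will absorb it.
\<close>

lemma bump_slowly_varying:
  fixes i n k :: "int ^ 'd::finite"
  assumes "0 \<le> \<epsilon>" "\<epsilon> \<le> 1"
  shows "\<bar>bump \<epsilon> (n - k) - bump \<epsilon> (i - k)\<bar> \<le>
    \<epsilon> * (1 + real_of_int (sup_abs (i - n))) ^ (2 * CARD('d)) * bump \<epsilon> (n - k)"
proof -
  define \<delta> where "\<delta> = real_of_int (sup_abs (i - n))"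
  define s t where "s = real_of_int (sup_abs (i - k))" and "t = real_of_int (sup_abs (n - k))"
  define P Q E where "P = (1 + \<epsilon> * s) ^ (2 * CARD('d))" and "Q = (1 + \<epsilon> * t) ^ (2 * CARD('d))"
    and "E = (1 + \<epsilon> * \<delta>) ^ (2 * CARD('d))"
  have nn: "0 \<le> \<delta>" "0 \<le> s" "0 \<le> t" by (auto simp: \<delta>_def s_def t_def sup_abs_nonneg)
  have "\<bar>s - t\<bar> \<le> \<delta>"
    using abs_diff_sup_abs_le[of i k n] unfolding \<delta>_def s_def t_def by linarith
  then have st: "s \<le> t + \<delta>" "t \<le> s + \<delta>" by auto
  have step: "1 + \<epsilon> * a \<le> (1 + \<epsilon> * b) * (1 + \<epsilon> * \<delta>)" if "a \<le> b + \<delta>" "0 \<le> b" for a b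
  proof -
    have "\<epsilon> * a \<le> \<epsilon> * (b + \<delta>)" using that assms by (intro mult_left_mono)
    moreover have "0 \<le> (\<epsilon> * b) * (\<epsilon> * \<delta>)" using that assms nn by simp
    ultimately show ?thesis by (simp add: algebra_simps)
  qed
  have "P \<le> Q * E" "Q \<le> P * E"
    unfolding P_def Q_def E_def power_mult_distrib[symmetric]
    using assms nn st by (intro power_mono step add_nonneg_nonneg mult_nonneg_nonneg; simp)+
  moreover have "1 \<le> E" unfolding E_def using assms nn by (intro one_le_power) simp
  moreover have pos: "0 < P" "0 < Q" unfolding P_def Q_def 
    using assms nn by (intro zero_less_power add_pos_nonneg mult_nonneg_nonneg; simp)+
  ultimately have PQ: "P - Q \<le> (E - 1) * Q" "Q - P \<le> (E - 1) * P" and E0: "0 \<le> E - 1"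
    by (simp_all add: algebra_simps)
  have PQE: "\<bar>P - Q\<bar> \<le> (E - 1) * P"
  proof (cases "Q \<le> P")
    case True
    from True E0 have "(E - 1) * Q \<le> (E - 1) * P" by (rule mult_left_mono)
    with PQ(1) True show ?thesis by linarith
  next
    case False
    with PQ(2) show ?thesis by linarith
  qed
  have "bump \<epsilon> (n - k) - bump \<epsilon> (i - k) = inverse Q - inverse P"
    by (simp add: bump_def P_def Q_def s_def t_def)
  also have "\<dots> = (P - Q) / (P * Q)" using pos by (simp add: field_simps)
  finally have "\<bar>bump \<epsilon> (n - k) - bump \<epsilon> (i - k)\<bar> = \<bar>P - Q\<bar> / (P * Q)"
    using pos by (simp add: abs_mult)
  also have "\<dots> \<le> ((E - 1) * P) / (P * Q)"
    using PQE pos by (intro divide_right_mono) simp_all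
  also have "\<dots> = (E - 1) * inverse Q" using pos by (simp add: field_simps)
  also have "\<dots> \<le> \<epsilon> * (1 + \<delta>) ^ (2 * CARD('d)) * inverse Q"
  proof (rule mult_right_mono)
    have "E - 1 \<le> \<epsilon> * ((1 + \<delta>) ^ (2 * CARD('d)) - 1)"
      unfolding E_def using assms nn by (intro one_plus_scaled_power_le)
    also have "\<dots> \<le> \<epsilon> * (1 + \<delta>) ^ (2 * CARD('d))" using assms by (simp add: right_diff_distrib)
    finally show "E - 1 \<le> \<epsilon> * (1 + \<delta>) ^ (2 * CARD('d))" .
  qed (use pos in auto)
  finally show ?thesis by (simp add: bump_def Q_def t_def \<delta>_def)
qed

section \<open>Unconditional sums in a Banach space with a carrier\<close>

lemma complex_field_simps [simp]:
  "carrier complex_field = UNIV" "a \<oplus>\<^bsub>complex_field\<^esub> b = a + b" "\<one>\<^bsub>complex_field\<^esub> = 1"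
  by (simp_all add: complex_field_def)

context complex_normed_space
begin

definition has_usum :: "('i \<Rightarrow> 'a) \<Rightarrow> 'a \<Rightarrow> bool" where
  "has_usum y s \<longleftrightarrow> limitin metric.mtopology (finsum M y) s (finite_subsets_at_top UNIV)"

lemma has_usum_carrier: "has_usum y s \<Longrightarrow> s \<in> carrier M"
  by (simp add: has_usum_def metric.limitin_metric)

lemma has_usum_close:
  assumes "has_usum y s" "0 < e"
  shows "\<forall>\<^sub>F F in finite_subsets_at_top UNIV. finsum M y F \<in> carrier M \<and> vdist M (finsum M y F) s < e"
  using assms by (auto simp: has_usum_def metric.limitin_metric)

lemma the_usum_eq:
  assumes "has_usum y s"
  shows "(THE s. limitin metric.mtopology (finsum M y) s (finite_subsets_at_top UNIV)) = s"
  using assms metric.limitin_metric_unique[OF _ _ finite_subsets_at_top_neq_bot]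
  unfolding has_usum_def by (intro the_equality) blast+

lemma vnorm_zero [simp]: "vnorm M \<zero>\<^bsub>M\<^esub> = 0"
  by (simp add: vnorm_eq_0_iff)

lemma vnorm_finsum_le:
  assumes "finite F" "\<And>n. y n \<in> carrier M"
  shows "vnorm M (finsum M y F) \<le> (\<Sum>n\<in>F. vnorm M (y n))"
  using assms(1)
proof (induction rule: finite_induct)
  case (insert n F)
  then have "finsum M y (insert n F) = y n \<oplus>\<^bsub>M\<^esub> finsum M y F"
    using assms(2) by (intro M.finsum_insert) auto
  then show ?case
    using insert assms(2) vnorm_triangle[of "y n" "finsum M y F"] by fastforce
qed simp

lemma vnorm_diff_triangle:
  assumes "a \<in> carrier M" "b \<in> carrier M"
  shows "vnorm M a \<le> vnorm M b + vdist M a b"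
proof -
  have "(a \<ominus>\<^bsub>M\<^esub> b) \<oplus>\<^bsub>M\<^esub> b = a"
    using assms by (simp add: M.minus_eq M.a_assoc M.l_neg)
  then show ?thesis
    using vnorm_triangle[of "a \<ominus>\<^bsub>M\<^esub> b" b] assms by (simp add: vdist_def)
qed

lemma vdist_finsum_subset:
  assumes "finite G" "F \<subseteq> G" "\<And>n. y n \<in> carrier M"
  shows "vdist M (finsum M y G) (finsum M y F) \<le> (\<Sum>n\<in>G - F. vnorm M (y n))"
proof -
  have fin: "finite F" "finite (G - F)" using assms finite_subset by auto
  have "finsum M y ((G - F) \<union> F) = finsum M y (G - F) \<oplus>\<^bsub>M\<^esub> finsum M y F"
    using fin assms(3) by (intro M.finsum_Un_disjoint) auto
  moreover have "(G - F) \<union> F = G" using assms(2) by blast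
  ultimately have "finsum M y G \<ominus>\<^bsub>M\<^esub> finsum M y F = finsum M y (G - F)"
    using assms(3) by (simp add: M.minus_eq M.a_assoc M.r_neg)
  then show ?thesis
    using vnorm_finsum_le[of "G - F" y] fin assms(3) by (simp add: vdist_def)
qed

text \<open>
  Multiplying the terms of a sum by \<open>\<phi>\<close> almost amounts to multiplying the sum by a constant \<open>c\<close> if
  \<open>\<phi>\<close> is close to \<open>c\<close> where the terms are large. With the bump as \<open>\<phi>\<close> and its value on the diagonal
  as \<open>c\<close>, this is the estimate of the commutator of the matrix with the bump.
\<close>

lemma vnorm_usum_multiplier_le:
  assumes y: "\<And>n. y n \<in> carrier M"
    and s: "has_usum y s" and t: "has_usum (\<lambda>n. complex_of_real (\<phi> n) \<odot>\<^bsub>M\<^esub> y n) t"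
    and c: "0 \<le> c" and sum: "(\<lambda>n. \<bar>\<phi> n - c\<bar> * vnorm M (y n)) summable_on UNIV"
  shows "vnorm M t \<le> c * vnorm M s + (\<Sum>\<^sub>\<infinity>n. \<bar>\<phi> n - c\<bar> * vnorm M (y n))"
proof (rule field_le_epsilon)
  fix e :: real assume e: "0 < e"
  \<comment> \<open>an error \<open>d\<close> in both partial sums costs \<open>c * d + d = e\<close>\<close>
  define d where "d = e / (c + 1)"
  have d: "0 < d" using e c by (simp add: d_def)
  let ?z = "\<lambda>n. complex_of_real (\<phi> n) \<odot>\<^bsub>M\<^esub> y n"
  let ?r = "\<lambda>n. complex_of_real (\<phi> n - c) \<odot>\<^bsub>M\<^esub> y n"
  have "\<forall>\<^sub>F F in finite_subsets_at_top UNIV. finite F"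
    by (rule eventually_finite_subsets_at_top_weakI)
  then have "\<forall>\<^sub>F F in finite_subsets_at_top UNIV. finite F \<and> vdist M (finsum M y F) s < d
      \<and> vdist M (finsum M ?z F) t < d"
    using has_usum_close[OF s d] has_usum_close[OF t d]
    by eventually_elim auto
  then obtain F where F: "finite F" "vdist M (finsum M y F) s < d" "vdist M (finsum M ?z F) t < d"
    by (metis (mono_tags, lifting) eventually_happens' finite_subsets_at_top_neq_bot)
  have carr: "?z n \<in> carrier M" "?r n \<in> carrier M" "complex_of_real c \<odot>\<^bsub>M\<^esub> y n \<in> carrier M" for n
    using y by (auto intro: smult_closed)
  have split: "?z n = complex_of_real c \<odot>\<^bsub>M\<^esub> y n \<oplus>\<^bsub>M\<^esub> ?r n" for n
    using smult_l_distr[of "complex_of_real c" "complex_of_real (\<phi> n - c)" "y n"] y by simp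
  have "finsum M ?z F = finsum M (\<lambda>n. complex_of_real c \<odot>\<^bsub>M\<^esub> y n) F \<oplus>\<^bsub>M\<^esub> finsum M ?r F"
    unfolding split using carr by (intro M.finsum_addf) auto
  also have "finsum M (\<lambda>n. complex_of_real c \<odot>\<^bsub>M\<^esub> y n) F = complex_of_real c \<odot>\<^bsub>M\<^esub> finsum M y F"
    using F(1) y by (intro finsum_smult_ldistr[symmetric]) auto
  finally have "vnorm M (finsum M ?z F) \<le> vnorm M (complex_of_real c \<odot>\<^bsub>M\<^esub> finsum M y F) + vnorm M (finsum M ?r F)"
    using carr y by (simp add: vnorm_triangle smult_closed)
  also have "vnorm M (complex_of_real c \<odot>\<^bsub>M\<^esub> finsum M y F) = c * vnorm M (finsum M y F)"
    using c y by (subst vnorm_smult) auto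
  also have "vnorm M (finsum M y F) \<le> vnorm M s + d"
    using vnorm_diff_triangle[of "finsum M y F" s] F has_usum_carrier[OF s] y by fastforce
  also have "vnorm M (finsum M ?r F) \<le> (\<Sum>n\<in>F. vnorm M (?r n))"
    using F(1) carr by (intro vnorm_finsum_le) auto
  also have "\<dots> = (\<Sum>n\<in>F. \<bar>\<phi> n - c\<bar> * vnorm M (y n))"
    using y by (intro sum.cong refl) (simp add: vnorm_smult norm_of_real del: of_real_diff)
  also have "\<dots> \<le> (\<Sum>\<^sub>\<infinity>n. \<bar>\<phi> n - c\<bar> * vnorm M (y n))"
    using sum y F(1) by (intro finite_sum_le_nonneg_infsum) (auto simp: vnorm_nonneg)
  finally have "vnorm M (finsum M ?z F) \<le> c * (vnorm M s + d) + (\<Sum>\<^sub>\<infinity>n. \<bar>\<phi> n - c\<bar> * vnorm M (y n))"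
    using c by (simp add: mult_left_mono)
  moreover have "vnorm M t \<le> vnorm M (finsum M ?z F) + d"
    using vnorm_diff_triangle[of t "finsum M ?z F"] F has_usum_carrier[OF t] carr metric.commute
    by fastforce
  moreover have "(c + 1) * d = e" using c by (simp add: d_def)
  then have "c * d + d = e" by (simp add: distrib_right)
  ultimately show "vnorm M t \<le> c * vnorm M s + (\<Sum>\<^sub>\<infinity>n. \<bar>\<phi> n - c\<bar> * vnorm M (y n)) + e"
    by (simp add: algebra_simps)
qed

lemma vnorm_usum_le:
  assumes y: "\<And>n. y n \<in> carrier M" and s: "has_usum y s"
    and sum: "(\<lambda>n. vnorm M (y n)) summable_on UNIV"
  shows "vnorm M s \<le> (\<Sum>\<^sub>\<infinity>n. vnorm M (y n))"
proof -
  have "complex_of_real 1 \<odot>\<^bsub>M\<^esub> y n = y n" for n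
    using smult_one[of "y n"] y by simp
  then show ?thesis
    using vnorm_usum_multiplier_le[of y s "\<lambda>_. 1" s 0] assms by simp
qed

end

context complex_banach_space
begin

text \<open>
  Absolute convergence implies unconditional convergence. Completeness is available only for
  sequences, so the partial sums are first taken along finite sets \<open>F i\<close> outside of which every finite
  sum of norms is below \<open>1 / (i + 1)\<close>; their limit is then the limit of the whole net.
\<close>

lemma has_usum_exists:
  assumes y: "\<And>n. y n \<in> carrier M" and sum: "(\<lambda>n. vnorm M (y n)) summable_on UNIV"
  shows "\<exists>s. has_usum y s"
proof -
  let ?N = "\<lambda>n. vnorm M (y n)"
  have tail: "\<exists>F. finite F \<and> (\<forall>G. finite G \<longrightarrow> F \<subseteq> G \<longrightarrow> sum ?N (G - F) < e)" if "0 < e" for e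
  proof -
    define S where "S = infsum ?N UNIV"
    from that have "0 < e / 2" by simp
    from has_sum_finite_approximation[OF has_sum_infsum[OF sum] this]
    obtain F where "finite F" "dist (sum ?N F) S \<le> e / 2" unfolding S_def by blast
    with that have F: "finite F" "dist (sum ?N F) S < e" by simp_all
    have "sum ?N (G - F) < e" if "finite G" "F \<subseteq> G" for G
    proof -
      have "sum ?N (G - F) = sum ?N G - sum ?N F" using that F by (simp add: sum_diff)
      moreover have "sum ?N G \<le> S"
        unfolding S_def using that sum y by (intro finite_sum_le_nonneg_infsum) (auto simp: vnorm_nonneg)
      ultimately show ?thesis using F(2) by (simp add: dist_real_def abs_real_def split: if_splits)
    qed
    with F show ?thesis by blast
  qed
  have "\<exists>F. \<forall>i. finite (F i) \<and> (\<forall>G. finite G \<longrightarrow> F i \<subseteq> G \<longrightarrow> sum ?N (G - F i) < 1 / real (Suc i))"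
    by (rule choice, rule allI, rule tail) simp
  then obtain F where F: "\<And>i. finite (F i)"
    "\<And>i G. finite G \<Longrightarrow> F i \<subseteq> G \<Longrightarrow> sum ?N (G - F i) < 1 / real (Suc i)" by blast
  have close: "vdist M (finsum M y G) (finsum M y (F i)) < 1 / real (Suc i)"
    if "finite G" "F i \<subseteq> G" for i G
    using vdist_finsum_subset[OF that, of y] y F(2)[OF that] by fastforce
  have carr: "finsum M y G \<in> carrier M" for G using y by (intro M.finsum_closed) auto
  have "metric.MCauchy (\<lambda>i. finsum M y (F i))"
    unfolding metric.MCauchy_def
  proof (intro conjI allI impI)
    fix e :: real assume "0 < e"
    then obtain N where N: "1 / real (Suc N) < e / 2"
      using reals_Archimedean[of "e / 2"] by (auto simp: inverse_eq_divide)
    have "vdist M (finsum M y (F i)) (finsum M y (F j)) < e" if "N \<le> i" "N \<le> j" for i j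
    proof -
      let ?G = "F i \<union> F j"
      have "vdist M (finsum M y (F i)) (finsum M y (F j)) \<le>
          vdist M (finsum M y ?G) (finsum M y (F i)) + vdist M (finsum M y ?G) (finsum M y (F j))"
        using metric.triangle[of "finsum M y (F i)" "finsum M y ?G" "finsum M y (F j)"]
          metric.commute carr by simp
      moreover have "1 / real (Suc i) \<le> 1 / real (Suc N)" "1 / real (Suc j) \<le> 1 / real (Suc N)"
        using that by (auto simp: frac_le)
      ultimately show ?thesis using close[of ?G i] close[of ?G j] F(1) N by simp
    qed
    then show "\<exists>N. \<forall>i j. N \<le> i \<longrightarrow> N \<le> j \<longrightarrow> vdist M (finsum M y (F i)) (finsum M y (F j)) < e"
      by blast
  qed (use carr in auto)
  then obtain s where "limitin metric.mtopology (\<lambda>i. finsum M y (F i)) s sequentially"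
    using complete unfolding metric.mcomplete_def by blast
  then have s: "s \<in> carrier M"
    "\<And>e. 0 < e \<Longrightarrow> \<exists>N. \<forall>i\<ge>N. vdist M (finsum M y (F i)) s < e"
    unfolding metric.limit_metric_sequentially by blast+
  have "\<forall>\<^sub>F G in finite_subsets_at_top UNIV. finsum M y G \<in> carrier M \<and> vdist M (finsum M y G) s < e"
    if "0 < e" for e
  proof -
    obtain N1 where N1: "1 / real (Suc N1) < e / 2"
      using reals_Archimedean[of "e / 2"] \<open>0 < e\<close> by (auto simp: inverse_eq_divide)
    obtain N2 where N2: "\<And>i. N2 \<le> i \<Longrightarrow> vdist M (finsum M y (F i)) s < e / 2"
      using s(2)[of "e / 2"] \<open>0 < e\<close> by auto
    let ?i = "max N1 N2"
    have "vdist M (finsum M y G) s < e" if G: "finite G" "F ?i \<subseteq> G" for G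
    proof -
      have "vdist M (finsum M y G) s \<le>
          vdist M (finsum M y G) (finsum M y (F ?i)) + vdist M (finsum M y (F ?i)) s"
        using metric.triangle carr s(1) by simp
      moreover have "1 / real (Suc ?i) \<le> 1 / real (Suc N1)" by (auto simp: frac_le)
      ultimately show ?thesis using close[OF G] N1 N2[of ?i] by simp
    qed
    then show ?thesis using F(1)[of ?i] carr by (auto simp: eventually_finite_subsets_at_top)
  qed
  then have "has_usum y s" using s(1) by (auto simp: has_usum_def metric.limitin_metric)
  then show ?thesis ..
qed

end

section \<open>Off-diagonal decay of the entries\<close>

lemma vnorm_le_op_norm:
  assumes V: "complex_normed_space V" and W: "complex_normed_space W"
    and f: "bounded_operator V W f" and x: "x \<in> carrier V"
  shows "vnorm W (f x) \<le> op_norm V W f * vnorm V x"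
proof -
  interpret V: complex_normed_space V by (fact V)
  interpret W: complex_normed_space W by (fact W)
  from f obtain C where fW: "f \<in> carrier V \<rightarrow> carrier W"
    and smult: "\<And>c x. x \<in> carrier V \<Longrightarrow> f (c \<odot>\<^bsub>V\<^esub> x) = c \<odot>\<^bsub>W\<^esub> f x"
    and C: "\<And>x. x \<in> carrier V \<Longrightarrow> vnorm W (f x) \<le> C * vnorm V x"
    unfolding bounded_operator_def by blast
  show ?thesis
  proof (cases "vnorm V x = 0")
    case True
    then show ?thesis using C[OF x] by simp
  next
    case False
    then have pos: "0 < vnorm V x" using V.vnorm_nonneg[OF x] by simp
    let ?z = "complex_of_real (1 / vnorm V x) \<odot>\<^bsub>V\<^esub> x"
    have z: "?z \<in> carrier V" using x by (intro V.smult_closed) auto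
    have "vnorm W (f y) \<le> \<bar>C\<bar>" if "y \<in> carrier V" "vnorm V y \<le> 1" for y
    proof -
      have "C * vnorm V y \<le> \<bar>C\<bar> * 1"
        using that V.vnorm_nonneg by (intro mult_mono) auto
      with C[OF that(1)] show ?thesis by simp
    qed
    then have bdd: "bdd_above ((\<lambda>y. vnorm W (f y)) ` {y \<in> carrier V. vnorm V y \<le> 1})"
      by (intro bdd_aboveI2) auto
    have "vnorm V ?z = 1"
      using pos by (subst V.vnorm_smult[OF x]) (simp add: norm_divide)
    with z have "vnorm W (f ?z) \<le> op_norm V W f"
      unfolding op_norm_def by (intro cSUP_upper[OF _ bdd]) simp
    moreover have "vnorm W (f ?z) = vnorm W (f x) / vnorm V x"
      using x fW pos by (subst smult[OF x], subst W.vnorm_smult) (auto simp: norm_divide)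
    ultimately have "vnorm W (f x) / vnorm V x \<le> op_norm V W f" by simp
    then show ?thesis using pos by (simp only: pos_divide_le_eq)
  qed
qed

text \<open>
  Outside the carrier, multiplication by \<open>1\<close> is arbitrary, so the slant agrees with the matrix
  only on the carrier. The operator norm does not see the difference.
\<close>

lemma op_norm_slant:
  assumes V: "\<And>n. complex_normed_space (X n)" and W: "\<And>m. complex_normed_space (Y m)"
    and f: "bounded_operator (X n) (Y m) (A m n)"
  shows "op_norm (X n) (Y m) (slant \<alpha> Y A (slope_floor \<alpha> m - n) m n) = op_norm (X n) (Y m) (A m n)"
proof -
  interpret W: complex_normed_space "Y m" by (fact W)
  have one: "(\<Prod>k\<in>UNIV. indicator {real_of_int ((slope_floor \<alpha> m - n) $ k)..<
        real_of_int ((slope_floor \<alpha> m - n) $ k) + 1} (\<alpha> * real_of_int (m $ k) - real_of_int (n $ k))) = (1::complex)"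
  proof (intro prod.neutral ballI)
    fix k
    have "\<alpha> * real_of_int (m $ k) - real_of_int (n $ k) \<in>
        {real_of_int ((slope_floor \<alpha> m - n) $ k)..<real_of_int ((slope_floor \<alpha> m - n) $ k) + 1}"
      by (simp add: slope_floor_def)
    then show "indicator {real_of_int ((slope_floor \<alpha> m - n) $ k)..<
        real_of_int ((slope_floor \<alpha> m - n) $ k) + 1} (\<alpha> * real_of_int (m $ k) - real_of_int (n $ k)) = (1::complex)"
      by (rule indicator_simps(1))
  qed
  have "slant \<alpha> Y A (slope_floor \<alpha> m - n) m n x = A m n x" if "x \<in> carrier (X n)" for x
  proof -
    have "A m n x \<in> carrier (Y m)" using f that by (auto simp: bounded_operator_def)
    then show ?thesis unfolding slant_def one using W.smult_one[of "A m n x"] by simp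
  qed
  then show ?thesis unfolding op_norm_def by (intro arg_cong[of _ _ Sup] image_cong) auto
qed

text \<open>
  What the argument retains of a matrix with slanted decay: \<open>h m\<close> is the position of the diagonal
  in row \<open>m\<close>, and \<open>b\<close> is a summable profile of the decay away from it.
\<close>

locale localized_matrix =
  fixes X :: "int ^ 'd::finite \<Rightarrow> 'a normed_module"
    and Y :: "int ^ 'd \<Rightarrow> 'b normed_module"
    and A :: "(int ^ 'd, 'a, 'b) op_matrix"
    and h :: "int ^ 'd \<Rightarrow> int ^ 'd"
    and K :: nat
    and b :: "int ^ 'd \<Rightarrow> real"
  assumes X_space: "\<And>n. complex_banach_space (X n)"
    and Y_space: "\<And>m. complex_banach_space (Y m)"
    and entry_operator: "\<And>m n. bounded_operator (X n) (Y m) (A m n)"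
    and h_fibres: "bounded_fibres K h"
    and b_nonneg: "\<And>j. 0 \<le> b j"
    and b_summable: "(\<lambda>j. b j * (1 + real_of_int (sup_abs j)) ^ (2 * CARD('d))) summable_on UNIV"
    and entry_bound: "\<And>m n x. x \<in> carrier (X n) \<Longrightarrow>
      vnorm (Y m) (A m n x) \<le> b (h m - n) * vnorm (X n) x"

text \<open>
  The profile \<open>b j\<close> is the norm of the \<open>j\<close>-th slant. It is real because the weight is nowhere zero,
  so that a finite weighted sum in the extended reals has finite terms.
\<close>

lemma slant_class_localized:
  fixes X :: "int ^ 'd::finite \<Rightarrow> 'a normed_module" and Y :: "int ^ 'd \<Rightarrow> 'b normed_module"
  assumes "\<alpha> \<noteq> 0"
    and X: "\<And>n. complex_banach_space (X n)" and Y: "\<And>n. complex_banach_space (Y n)"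
    and s: "2 * real CARD('d) \<le> s"
    and \<omega>: "\<And>j. \<omega> j = (1 + real_of_int (sup_abs j)) powr s"
    and A: "A \<in> slant_class \<alpha> \<omega> X Y"
  obtains K b where "localized_matrix X Y A (slope_floor \<alpha>) K b"
proof -
  define N where "N j = matrix_sup_norm X Y (slant \<alpha> Y A j)" for j
  define S where "S = (\<Sum>\<^sub>\<infinity>j. N j * ennreal (\<omega> j))"
  have op: "bounded_operator (X n) (Y m) (A m n)" for m n using A by (auto simp: slant_class_def)
  have Xn: "complex_normed_space (X n)" and Yn: "complex_normed_space (Y n)" for n
    using X[of n] Y[of n] by (auto simp: complex_banach_space_def)
  have "of_nat (nat \<lceil>1 / \<bar>\<alpha>\<bar>\<rceil> ^ CARD('d)) * S < top_class.top"
    using A by (auto simp: slant_class_def slant_norm_def S_def N_def infinity_ennreal_def)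
  moreover have "0 < nat \<lceil>1 / \<bar>\<alpha>\<bar>\<rceil>" using assms(1) by simp
  ultimately have S: "S < top_class.top" by (auto simp: ennreal_mult_less_top)
  have sum_le: "(\<Sum>j\<in>F. N j * ennreal (\<omega> j)) \<le> S" if "finite F" for F
    unfolding S_def using that
    by (subst nonneg_infsum_complete) (auto intro: SUP_upper)
  have base: "1 \<le> 1 + real_of_int (sup_abs j)" for j :: "int ^ 'd" using sup_abs_nonneg[of j] by simp
  have \<omega>_ge: "(1 + real_of_int (sup_abs j)) ^ (2 * CARD('d)) \<le> \<omega> j" for j
  proof -
    have "(1 + real_of_int (sup_abs j)) powr real (2 * CARD('d)) \<le> \<omega> j"
      unfolding \<omega> using s base[of j] by (intro powr_mono) auto
    moreover have "(1 + real_of_int (sup_abs j)) powr real (2 * CARD('d)) = (1 + real_of_int (sup_abs j)) ^ (2 * CARD('d))"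
      using base[of j] by (intro powr_realpow) linarith
    ultimately show ?thesis by simp
  qed
  have \<omega>_pos: "1 \<le> \<omega> j" for j using \<omega>_ge[of j] one_le_power[OF base, of j] order_trans by blast
  have N_fin: "N j < top_class.top" for j
  proof -
    have "N j * ennreal (\<omega> j) < top_class.top" using sum_le[of "{j}"] S by (simp add: le_less_trans)
    moreover have "ennreal (\<omega> j) \<noteq> 0" using \<omega>_pos[of j] by simp
    ultimately show ?thesis by (auto simp: ennreal_mult_less_top)
  qed
  define b where "b j = enn2real (N j)" for j
  have b_nn: "0 \<le> b j" for j by (simp add: b_def)
  have bN: "ennreal (b j) = N j" for j using N_fin by (simp add: b_def)
  have "(\<Sum>j\<in>F. b j * (1 + real_of_int (sup_abs j)) ^ (2 * CARD('d))) \<le> enn2real S" if "finite F" for F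
  proof -
    have "ennreal (\<Sum>j\<in>F. b j * \<omega> j) = (\<Sum>j\<in>F. ennreal (b j * \<omega> j))"
      using \<omega>_pos by (intro sum_ennreal[symmetric]) (auto intro!: mult_nonneg_nonneg b_nn intro: order_trans[of 0 1])
    also have "\<dots> = (\<Sum>j\<in>F. N j * ennreal (\<omega> j))"
    proof (rule sum.cong[OF refl])
      fix j
      have "ennreal (b j * \<omega> j) = ennreal (b j) * ennreal (\<omega> j)"
        using \<omega>_pos[of j] by (intro ennreal_mult b_nn) linarith
      then show "ennreal (b j * \<omega> j) = N j * ennreal (\<omega> j)" by (simp only: bN)
    qed
    also have "\<dots> \<le> S" by (rule sum_le[OF that])
    also have "S = ennreal (enn2real S)" using S by simp
    finally have "(\<Sum>j\<in>F. b j * \<omega> j) \<le> enn2real S" by (simp add: ennreal_le_iff)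
    moreover have "(\<Sum>j\<in>F. b j * (1 + real_of_int (sup_abs j)) ^ (2 * CARD('d))) \<le> (\<Sum>j\<in>F. b j * \<omega> j)"
      using \<omega>_ge by (intro sum_mono mult_left_mono) (auto simp: b_def)
    ultimately show ?thesis by linarith
  qed
  then have b_sum: "(\<lambda>j. b j * (1 + real_of_int (sup_abs j)) ^ (2 * CARD('d))) summable_on UNIV"
    using order_trans[OF zero_le_one base]
    by (intro bounded_sums_summable(1) mult_nonneg_nonneg zero_le_power b_nn)
  have bound: "vnorm (Y m) (A m n x) \<le> b (slope_floor \<alpha> m - n) * vnorm (X n) x"
    if x: "x \<in> carrier (X n)" for m n x
  proof -
    let ?j = "slope_floor \<alpha> m - n"
    have "ennreal (op_norm (X n) (Y m) (A m n)) \<le> N ?j"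
      unfolding N_def matrix_sup_norm_def
      by (subst op_norm_slant[symmetric, OF Xn Yn op]) (intro SUP_upper2[of m] SUP_upper2[of n], auto)
    then have "op_norm (X n) (Y m) (A m n) \<le> b ?j"
      unfolding bN[symmetric] by (simp add: b_def ennreal_le_iff)
    then have "op_norm (X n) (Y m) (A m n) * vnorm (X n) x \<le> b ?j * vnorm (X n) x"
      using complex_normed_space.vnorm_nonneg[OF Xn x] by (intro mult_right_mono)
    with vnorm_le_op_norm[OF Xn Yn op x] show ?thesis by (rule order_trans)
  qed
  obtain K where "bounded_fibres K (slope_floor \<alpha> :: int ^ 'd \<Rightarrow> _)"
    using slope_floor_bounded_fibres[OF assms(1)] by blast
  from localized_matrix.intro[OF X Y op this b_nn b_sum bound]
  show ?thesis by (rule that)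
qed

section \<open>Localization of the lower bound\<close>

context localized_matrix
begin

lemma X_normed: "complex_normed_space (X n)" and Y_normed: "complex_normed_space (Y n)"
  using X_space[of n] Y_space[of n] by (auto simp: complex_banach_space_def)

text \<open>
  The kernel that dominates the commutators of the matrix with all bumps: the decay profile times
  the polynomial factor from \<open>bump_slowly_varying\<close>.
\<close>

definition weighted_kernel :: "int ^ 'd \<Rightarrow> int ^ 'd \<Rightarrow> real" where
  "weighted_kernel m n = b (h m - n) * (1 + real_of_int (sup_abs (h m - n))) ^ (2 * CARD('d))"

lemma weighted_kernel_schur: "\<exists>L. schur_kernel L weighted_kernel"
proof -
  have "0 \<le> b j * (1 + real_of_int (sup_abs j)) ^ (2 * CARD('d))" for j
    using b_nonneg[of j] sup_abs_nonneg[of j] by simp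
  from convolution_schur_kernel[OF h_fibres this b_summable]
  show ?thesis unfolding weighted_kernel_def .
qed

lemma b_le_weighted_kernel: "b (h m - n) \<le> weighted_kernel m n"
proof -
  have "1 \<le> (1 + real_of_int (sup_abs (h m - n))) ^ (2 * CARD('d))"
    using sup_abs_nonneg[of "h m - n"] by (intro one_le_power) simp
  from mult_left_mono[OF this b_nonneg] show ?thesis by (simp add: weighted_kernel_def)
qed

definition coord_norm :: "(int ^ 'd \<Rightarrow> 'a) \<Rightarrow> int ^ 'd \<Rightarrow> real" where
  "coord_norm x n = vnorm (X n) (x n)"

definition image_norm :: "(int ^ 'd \<Rightarrow> 'a) \<Rightarrow> int ^ 'd \<Rightarrow> real" where
  "image_norm x m = vnorm (Y m) (matrix_apply Y A x m)"

definition bounded_family :: "(int ^ 'd \<Rightarrow> 'a) \<Rightarrow> bool" where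
  "bounded_family x \<longleftrightarrow> (\<forall>n. x n \<in> carrier (X n)) \<and> (\<exists>B. \<forall>n. coord_norm x n \<le> B)"

lemma coord_norm_nonneg: "bounded_family x \<Longrightarrow> 0 \<le> coord_norm x n"
  using complex_normed_space.vnorm_nonneg[OF X_normed] by (simp add: bounded_family_def coord_norm_def)

lemma lp_space_iff:
  "x \<in> lp_space X p \<longleftrightarrow> (\<forall>n. x n \<in> carrier (X n)) \<and> lp_family p (coord_norm x)"
  using complex_normed_space.vnorm_nonneg[OF X_normed]
  by (auto simp: lp_space_def lp_family_def coord_norm_def)

lemma lp_norm_eq: "lp_norm X p x = family_norm p (coord_norm x)"
  by (simp add: lp_norm_def family_norm_def coord_norm_def)

lemma lp_norm_apply_eq: "lp_norm Y p (matrix_apply Y A x) = family_norm p (image_norm x)"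
  by (simp add: lp_norm_def family_norm_def image_norm_def)

lemma lp_space_bounded_family:
  assumes "p \<in> {1..\<infinity>}" "x \<in> lp_space X p"
  shows "bounded_family x"
proof -
  from assms(2) have x: "\<forall>n. x n \<in> carrier (X n)" and u: "lp_family p (coord_norm x)"
    by (simp_all add: lp_space_iff)
  from lp_bounded[OF assms(1) u] x show ?thesis unfolding bounded_family_def by blast
qed

lemma weighted_summable:
  assumes "bounded_family x"
  shows "(\<lambda>n. weighted_kernel m n * coord_norm x n) summable_on UNIV"
proof -
  obtain L where L: "schur_kernel L weighted_kernel" using weighted_kernel_schur by blast
  obtain B where B: "\<And>n. coord_norm x n \<le> B" using assms by (auto simp: bounded_family_def)
  show ?thesis by (rule schur_kernel_mult_summable(1)[OF L coord_norm_nonneg[OF assms] B])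
qed

lemma entries_image:
  assumes "bounded_family x"
  shows "A m n (x n) \<in> carrier (Y m)"
    and "vnorm (Y m) (A m n (x n)) \<le> weighted_kernel m n * coord_norm x n"
    and "(\<lambda>n. vnorm (Y m) (A m n (x n))) summable_on UNIV"
proof -
  have x: "\<And>n. x n \<in> carrier (X n)" using assms by (simp add: bounded_family_def)
  show carr: "A m n (x n) \<in> carrier (Y m)" for n
    using entry_operator[of n m] x by (auto simp: bounded_operator_def)
  show le: "vnorm (Y m) (A m n (x n)) \<le> weighted_kernel m n * coord_norm x n" for n
    using order_trans[OF entry_bound[OF x, of m n]
        mult_right_mono[OF b_le_weighted_kernel coord_norm_nonneg[OF assms, of n], unfolded coord_norm_def]]
    by (simp add: coord_norm_def)
  show "(\<lambda>n. vnorm (Y m) (A m n (x n))) summable_on UNIV"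
    using complex_normed_space.vnorm_nonneg[OF Y_normed carr]
    by (rule summable_mono(1)[OF _ le weighted_summable[OF assms]])
qed

lemma matrix_apply_has_usum:
  assumes "bounded_family x"
  shows "complex_normed_space.has_usum (Y m) (\<lambda>n. A m n (x n)) (matrix_apply Y A x m)"
proof -
  interpret Y: complex_banach_space "Y m" by (rule Y_space)
  from Y.has_usum_exists[of "\<lambda>n. A m n (x n)", OF entries_image(1)[OF assms] entries_image(3)[OF assms]]
  obtain s where s: "Y.has_usum (\<lambda>n. A m n (x n)) s" ..
  have "matrix_apply Y A x m = s"
    unfolding matrix_apply_def by (rule Y.the_usum_eq[OF s])
  with s show ?thesis by simp
qed

lemma image_norm_le:
  assumes "bounded_family x"
  shows "image_norm x m \<le> (\<Sum>\<^sub>\<infinity>n. weighted_kernel m n * coord_norm x n)"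
proof -
  interpret Y: complex_banach_space "Y m" by (rule Y_space)
  have "image_norm x m \<le> (\<Sum>\<^sub>\<infinity>n. vnorm (Y m) (A m n (x n)))"
    unfolding image_norm_def
    by (intro Y.vnorm_usum_le matrix_apply_has_usum entries_image assms)
  also have "\<dots> \<le> (\<Sum>\<^sub>\<infinity>n. weighted_kernel m n * coord_norm x n)"
    using entries_image(1)[OF assms]
    by (intro summable_mono(2) entries_image(2) weighted_summable assms Y.vnorm_nonneg)
  finally show ?thesis .
qed

lemma image_norm_nonneg:
  assumes "bounded_family x"
  shows "0 \<le> image_norm x m"
proof -
  interpret Y: complex_banach_space "Y m" by (rule Y_space)
  show ?thesis unfolding image_norm_def
    using Y.has_usum_carrier[OF matrix_apply_has_usum[OF assms]] by (rule Y.vnorm_nonneg)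
qed

lemma image_lp:
  assumes "p \<in> {1..\<infinity>}" "x \<in> lp_space X p"
  shows "lp_family p (image_norm x)"
proof -
  have x: "bounded_family x" by (rule lp_space_bounded_family[OF assms])
  have u: "lp_family p (coord_norm x)" using assms(2) by (simp add: lp_space_iff)
  obtain L where L: "schur_kernel L weighted_kernel" using weighted_kernel_schur by blast
  show ?thesis
    by (rule lp_mono(1)[OF assms(1) schur_test(1)[OF assms(1) L u]
          image_norm_nonneg[OF x] image_norm_le[OF x]])
qed

definition localize :: "real \<Rightarrow> int ^ 'd \<Rightarrow> (int ^ 'd \<Rightarrow> 'a) \<Rightarrow> int ^ 'd \<Rightarrow> 'a" where
  "localize \<epsilon> k x n = complex_of_real (bump \<epsilon> (n - k)) \<odot>\<^bsub>X n\<^esub> x n"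

lemma coord_norm_localize:
  assumes "bounded_family x" "0 \<le> \<epsilon>"
  shows "coord_norm (localize \<epsilon> k x) n = bump \<epsilon> (n - k) * coord_norm x n"
  using assms bump_pos[of \<epsilon> "n - k"] complex_normed_space.vnorm_smult[OF X_normed]
  by (simp add: coord_norm_def localize_def bounded_family_def)

lemma localize_carrier:
  assumes "bounded_family x"
  shows "localize \<epsilon> k x n \<in> carrier (X n)"
proof -
  interpret X: complex_normed_space "X n" by (rule X_normed)
  show ?thesis using assms by (auto simp: localize_def bounded_family_def intro!: X.smult_closed)
qed

lemma bump_schur:
  assumes "0 < \<epsilon>"
  shows "\<exists>L. schur_kernel L (\<lambda>k m. bump \<epsilon> (h m - k))"
proof -
  have "0 \<le> bump \<epsilon> i" for i :: "int ^ 'd" using bump_pos[of \<epsilon> i] assms by simp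
  from convolution_schur_kernel[OF h_fibres this bump_summable[OF assms]]
  show ?thesis using schur_kernel_transpose by blast
qed

lemma bump_translate_summable:
  assumes "0 < \<epsilon>"
  shows "(\<lambda>n. bump \<epsilon> (n - k)) summable_on (UNIV :: (int ^ 'd) set)"
proof -
  have "bij_betw (\<lambda>n. n - k) UNIV UNIV"
    by (rule bij_betw_byWitness[of _ "\<lambda>n. n + k"]) auto
  then show ?thesis using bump_summable[OF assms] by (subst summable_on_reindex_bij_betw)
qed

lemma localize_lp:
  assumes "bounded_family x" "0 < \<epsilon>" "p \<in> {1..\<infinity>}"
  shows "localize \<epsilon> k x \<in> lp_space X p"
proof -
  obtain B where B: "\<And>n. coord_norm x n \<le> B" using assms(1) by (auto simp: bounded_family_def)
  have le: "coord_norm (localize \<epsilon> k x) n \<le> bump \<epsilon> (n - k) * B" for n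
    using B[of n] bump_pos[of \<epsilon> "n - k"] assms by (simp add: coord_norm_localize mult_left_mono)
  have nonneg: "0 \<le> coord_norm (localize \<epsilon> k x) n" for n
    using coord_norm_nonneg[OF assms(1), of n] bump_pos[of \<epsilon> "n - k"] assms
    by (simp add: coord_norm_localize)
  have "coord_norm (localize \<epsilon> k x) summable_on UNIV"
    by (rule summable_mono(1)[OF nonneg le summable_on_cmult_left[OF bump_translate_summable[OF assms(2)]]])
  from summable_imp_lp(1)[OF assms(3) nonneg this] show ?thesis
    using localize_carrier[OF assms(1)] by (simp add: lp_space_iff)
qed

text \<open>
  The bump is compared in row \<open>m\<close> with its value at the diagonal position \<open>h m\<close>. The error is again
  a Schur kernel applied to the localized vector itself, not to \<open>x\<close>, and it is small with \<open>\<epsilon>\<close>.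
\<close>

lemma commutator_bound:
  assumes x: "bounded_family x" and \<epsilon>: "0 < \<epsilon>" "\<epsilon> \<le> 1"
  shows "image_norm (localize \<epsilon> k x) m \<le> bump \<epsilon> (h m - k) * image_norm x m +
    \<epsilon> * (\<Sum>\<^sub>\<infinity>n. weighted_kernel m n * coord_norm (localize \<epsilon> k x) n)"
proof -
  interpret Y: complex_banach_space "Y m" by (rule Y_space)
  let ?z = "localize \<epsilon> k x"
  let ?c = "\<lambda>n. \<bar>bump \<epsilon> (n - k) - bump \<epsilon> (h m - k)\<bar> * vnorm (Y m) (A m n (x n))"
  have z: "bounded_family ?z"
    using localize_lp[OF x \<epsilon>(1), of 1] lp_space_bounded_family[of 1] by simp
  have xc: "x n \<in> carrier (X n)" for n using x by (simp add: bounded_family_def)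
  have "A m n (?z n) = complex_of_real (bump \<epsilon> (n - k)) \<odot>\<^bsub>Y m\<^esub> A m n (x n)" for n
    using entry_operator[of n m] xc[of n] by (simp add: bounded_operator_def localize_def)
  then have usum: "Y.has_usum (\<lambda>n. complex_of_real (bump \<epsilon> (n - k)) \<odot>\<^bsub>Y m\<^esub> A m n (x n)) (matrix_apply Y A ?z m)"
    using matrix_apply_has_usum[OF z, of m] by simp
  have c_le: "?c n \<le> \<epsilon> * (weighted_kernel m n * coord_norm ?z n)" for n
  proof -
    have "?c n \<le> (\<epsilon> * (1 + real_of_int (sup_abs (h m - n))) ^ (2 * CARD('d)) * bump \<epsilon> (n - k)) *
        (b (h m - n) * coord_norm x n)"
      using \<epsilon> bump_pos[of \<epsilon> "n - k"] sup_abs_nonneg[of "h m - n"] entry_bound[OF xc]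
        Y.vnorm_nonneg entries_image(1)[OF x]
      by (intro mult_mono bump_slowly_varying) (auto simp: coord_norm_def)
    also have "\<dots> = \<epsilon> * (weighted_kernel m n * coord_norm ?z n)"
      using x \<epsilon> by (simp add: coord_norm_localize weighted_kernel_def mult_ac)
    finally show ?thesis .
  qed
  have c0: "0 \<le> ?c n" for n using Y.vnorm_nonneg entries_image(1)[OF x] by simp
  note c_sum = summable_mono[OF c0 c_le summable_on_cmult_right[OF weighted_summable[OF z]]]
  have "image_norm ?z m \<le> bump \<epsilon> (h m - k) * image_norm x m + (\<Sum>\<^sub>\<infinity>n. ?c n)"
    unfolding image_norm_def
    using bump_pos[of \<epsilon> "h m - k"] \<epsilon>
    by (intro Y.vnorm_usum_multiplier_le entries_image(1) x matrix_apply_has_usum usum c_sum(1)) auto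
  also have "(\<Sum>\<^sub>\<infinity>n. ?c n) \<le> (\<Sum>\<^sub>\<infinity>n. \<epsilon> * (weighted_kernel m n * coord_norm ?z n))" by (rule c_sum(2))
  also have "\<dots> = \<epsilon> * (\<Sum>\<^sub>\<infinity>n. weighted_kernel m n * coord_norm ?z n)"
    by (rule infsum_cmult_right) (rule weighted_summable[OF z])
  finally show ?thesis by simp
qed

text \<open>
  The lower bound in \<open>\<ell>\<^sup>p\<close> is applied to the localized vector. The commutator contributes at most
  \<open>4 * \<epsilon> * L\<close> times the norm of the localized vector, which the left-hand side absorbs when
  \<open>8 * \<epsilon> * L \<le> \<kappa>\<close>. What remains is the localized image, bounded by its \<open>\<ell>\<^sup>1\<close> norm, and
  \<open>\<epsilon>\<close> works for all \<open>x\<close> and \<open>k\<close> at once. The exponent \<open>p\<close> has disappeared from the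
  conclusion.
\<close>

lemma bounded_below_pointwise:
  assumes p: "p \<in> {1..\<infinity>}" and below: "bounded_below X Y A p"
  obtains \<epsilon> C where "0 < \<epsilon>" "0 < C"
    "\<And>x k. bounded_family x \<Longrightarrow> coord_norm x k \<le> C * (\<Sum>\<^sub>\<infinity>m. bump \<epsilon> (h m - k) * image_norm x m)"
proof -
  obtain \<kappa> where \<kappa>: "0 < \<kappa>" "\<And>x. x \<in> lp_space X p \<Longrightarrow> \<kappa> * family_norm p (coord_norm x) \<le> family_norm p (image_norm x)"
    using below by (auto simp: bounded_below_def lp_norm_eq lp_norm_apply_eq)
  obtain L where L: "schur_kernel L weighted_kernel" using weighted_kernel_schur by blast
  then have L0: "0 < L" by (simp add: schur_kernel_def)
  define \<epsilon> where "\<epsilon> = min 1 (\<kappa> / (8 * L))"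
  have \<epsilon>: "0 < \<epsilon>" "\<epsilon> \<le> 1" "8 * \<epsilon> * L \<le> \<kappa>"
    using \<kappa>(1) L0 by (auto simp: \<epsilon>_def min_def field_simps)
  show thesis
  proof (rule that)
    fix x k assume x: "bounded_family x"
    let ?z = "localize \<epsilon> k x"
    let ?P = "family_norm p (coord_norm ?z)"
    let ?y = "\<lambda>m. bump \<epsilon> (h m - k) * image_norm x m"
    let ?r = "\<lambda>m. \<Sum>\<^sub>\<infinity>n. weighted_kernel m n * coord_norm ?z n"
    have z: "?z \<in> lp_space X p" by (rule localize_lp[OF x \<epsilon>(1) p])
    then have zp: "lp_family p (coord_norm ?z)" by (simp add: lp_space_iff)
    have zb: "bounded_family ?z" by (rule lp_space_bounded_family[OF p z])
    obtain B where B: "\<And>n. coord_norm x n \<le> B" using x by (auto simp: bounded_family_def)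
    have img: "image_norm x m \<le> L * B" for m
      by (rule order_trans[OF image_norm_le[OF x] schur_kernel_mult_summable(2)[OF L coord_norm_nonneg[OF x] B]])
    obtain L' where L': "schur_kernel L' (\<lambda>k m. bump \<epsilon> (h m - k))" using bump_schur[OF \<epsilon>(1)] by blast
    have ys: "?y summable_on UNIV"
      by (rule schur_kernel_mult_summable(1)[OF L' image_norm_nonneg[OF x] img])
    have y0: "0 \<le> ?y m" for m
      using bump_pos[of \<epsilon> "h m - k"] \<epsilon> image_norm_nonneg[OF x, of m] by simp
    have y: "lp_family p ?y" "family_norm p ?y \<le> (\<Sum>\<^sub>\<infinity>m. ?y m)"
      by (rule summable_imp_lp[OF p y0 ys])+
    have r: "lp_family p ?r" "family_norm p ?r \<le> 2 * L * ?P"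
      by (rule schur_test[OF p L zp])+
    have er: "lp_family p (\<lambda>m. \<epsilon> * ?r m)" "family_norm p (\<lambda>m. \<epsilon> * ?r m) = \<epsilon> * family_norm p ?r"
      by (rule lp_cmult[OF p r(1) less_imp_le[OF \<epsilon>(1)]])+
    have yr: "lp_family p (\<lambda>m. ?y m + \<epsilon> * ?r m)"
      "family_norm p (\<lambda>m. ?y m + \<epsilon> * ?r m) \<le> 2 * (family_norm p ?y + family_norm p (\<lambda>m. \<epsilon> * ?r m))"
      by (rule lp_add[OF p y(1) er(1)])+
    have "\<kappa> * ?P \<le> family_norm p (image_norm ?z)" by (rule \<kappa>(2)[OF z])
    also have "\<dots> \<le> family_norm p (\<lambda>m. ?y m + \<epsilon> * ?r m)"
      by (intro lp_mono(2)[OF p yr(1)] image_norm_nonneg[OF zb] commutator_bound[OF x \<epsilon>(1,2)])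
    also have "\<dots> \<le> 2 * (family_norm p ?y + \<epsilon> * family_norm p ?r)" using yr(2) er(2) by simp
    also have "\<dots> \<le> 2 * ((\<Sum>\<^sub>\<infinity>m. ?y m) + \<epsilon> * (2 * L * ?P))"
      using y(2) r(2) \<epsilon>(1) by (intro mult_left_mono add_mono) auto
    also have "\<dots> = 2 * (\<Sum>\<^sub>\<infinity>m. ?y m) + (8 * \<epsilon> * L) * ?P / 2" by (simp add: algebra_simps)
    also have "\<dots> \<le> 2 * (\<Sum>\<^sub>\<infinity>m. ?y m) + \<kappa> * ?P / 2"
      using \<epsilon>(3) family_norm_nonneg[OF zp] by (intro add_left_mono divide_right_mono mult_right_mono) auto
    finally have "?P \<le> 4 / \<kappa> * (\<Sum>\<^sub>\<infinity>m. ?y m)" using \<kappa>(1) by (simp add: field_simps)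
    moreover have "coord_norm x k = coord_norm ?z k" using x \<epsilon> by (simp add: coord_norm_localize)
    ultimately show "coord_norm x k \<le> 4 / \<kappa> * (\<Sum>\<^sub>\<infinity>m. ?y m)"
      using lp_bounded[OF p zp, of k] by linarith
  qed (use \<epsilon> \<kappa> in auto)
qed

text \<open>
  The pointwise bound dominates \<open>x\<close> by a Schur kernel applied to its image, and Schur kernels act
  boundedly for every exponent.
\<close>

lemma bounded_below_transfer:
  assumes p: "p \<in> {1..\<infinity>}" and below: "bounded_below X Y A p" and q: "q \<in> {1..\<infinity>}"
  shows "bounded_below X Y A q"
proof -
  obtain \<epsilon> C where \<epsilon>: "0 < \<epsilon>" and C: "0 < C" and pointwise:
    "\<And>x k. bounded_family x \<Longrightarrow> coord_norm x k \<le> C * (\<Sum>\<^sub>\<infinity>m. bump \<epsilon> (h m - k) * image_norm x m)"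
    by (rule bounded_below_pointwise[OF p below]) blast
  obtain L where L: "schur_kernel L (\<lambda>k m. bump \<epsilon> (h m - k))" using bump_schur[OF \<epsilon>] by blast
  then have L0: "0 < L" by (simp add: schur_kernel_def)
  have "1 / (2 * C * L) * lp_norm X q x \<le> lp_norm Y q (matrix_apply Y A x)" if x: "x \<in> lp_space X q" for x
  proof -
    have xb: "bounded_family x" by (rule lp_space_bounded_family[OF q x])
    let ?T = "\<lambda>k. \<Sum>\<^sub>\<infinity>m. bump \<epsilon> (h m - k) * image_norm x m"
    have T: "lp_family q ?T" "family_norm q ?T \<le> 2 * L * family_norm q (image_norm x)"
      by (rule schur_test[OF q L image_lp[OF q x]])+
    have CT: "lp_family q (\<lambda>k. C * ?T k)" "family_norm q (\<lambda>k. C * ?T k) = C * family_norm q ?T"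
      by (rule lp_cmult[OF q T(1) less_imp_le[OF C]])+
    have "family_norm q (coord_norm x) \<le> C * family_norm q ?T"
      using lp_mono(2)[OF q CT(1) coord_norm_nonneg[OF xb] pointwise[OF xb]] CT(2) by simp
    also have "\<dots> \<le> C * (2 * L * family_norm q (image_norm x))"
      using C T(2) by (intro mult_left_mono) auto
    finally show ?thesis
      using C L0 by (simp add: lp_norm_eq lp_norm_apply_eq field_simps)
  qed
  moreover have "0 < 1 / (2 * C * L)" using C L0 by simp
  ultimately show ?thesis unfolding bounded_below_def by blast
qed

end

theorem theorem2p3:
  fixes \<alpha> s :: real
    and X :: "int ^ 'd::finite \<Rightarrow> 'a normed_module"
    and Y :: "int ^ 'd \<Rightarrow> 'b normed_module"
    and A :: "(int ^ 'd, 'a, 'b) op_matrix"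
    and \<omega> :: "int ^ 'd \<Rightarrow> real"
  assumes "\<alpha> \<noteq> 0"
    and "\<And>n. complex_banach_space (X n)"
    and "\<And>n. complex_banach_space (Y n)"
    and "s > (real CARD('d) + 1)\<^sup>2"
    and "\<And>j. \<omega> j = (1 + real_of_int (sup_abs j)) powr s"
    and "A \<in> slant_class \<alpha> \<omega> X Y"
  shows "(\<exists>p\<in>{1..\<infinity>}. bounded_below X Y A p) \<longleftrightarrow> (\<forall>q\<in>{1..\<infinity>}. bounded_below X Y A q)"
proof -
  \<comment> \<open>the weight dominates the factor \<open>(1 + \<bar>j\<bar>) ^ (2 * d)\<close> lost to the bumps\<close>
  have "2 * real CARD('d) \<le> (real CARD('d) + 1)\<^sup>2" by (simp add: power2_eq_square algebra_simps)
  with assms(4) have "2 * real CARD('d) \<le> s" by linarith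
  from slant_class_localized[OF assms(1-3) this assms(5,6)]
  obtain K b where "localized_matrix X Y A (slope_floor \<alpha>) K b" by metis
  then interpret localized_matrix X Y A "slope_floor \<alpha>" K b .
  show ?thesis
  proof
    assume "\<forall>q\<in>{1..\<infinity>}. bounded_below X Y A q"
    moreover have "1 \<in> {1..\<infinity>::ereal}" by simp
    ultimately show "\<exists>p\<in>{1..\<infinity>}. bounded_below X Y A p" by blast
  qed (use bounded_below_transfer in blast)
qed

end
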